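(* Let $A$ and $B$ be uniform algebras. Then every 2-local isometry $\Delta:A\to B$ is a linear map, and every 2-local (algebraic) isomorphism $\Delta:A\to B$ is a linear map. Furthermore, if every local isometry from $A$ into $B$ is a surjective isometry, then every 2-local isometry $\Delta:A\to B$ is a surjective linear isometry; respectively, if every local (algebraic) isomorphism from $A$ into $B$ is an isomorphism, then every 2-local isomorphism $\Delta:A\to B$ is an isomorphism.
   Context: A uniform algebra is a norm closed subalgebra of $C(K)$ (complex-valued continuous functions on a compact Hausdorff space $K$, supremum norm) which contains the constant functions and separates the points of $K$. $\mathrm{Iso}(A,B)$ denotes the set of all surjective linear isometries from $A$ onto $B$, and $\mathcal{G}(A,B)$ the set of all (bijective) algebra isomorphisms from $A$ onto $B$. A (not necessarily linear nor continuous) mapping $\Delta:A\to B$ is a 2-local isometry (respectively, a 2-local isomorphism) if for each $x,y\in A$ there exists $T_{x,y}$ in $\mathrm{Iso}(A,B)$ (respectively, in $\mathcal{G}(A,B)$), depending on $x$ and $y$, with $\Delta(x)=T_{x,y}(x)$ and $\Delta(y)=T_{x,y}(y)$. A linear mapping $\Delta:A\to B$ is a local isometry (respectively, a local isomorphism) if for each $x\in A$ there exists $T_x$ in $\mathrm{Iso}(A,B)$ (respectively, in $\mathcal{G}(A,B)$), depending on $x$, with $\Delta(x)=T_x(x)$. *)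

theory Defs
  imports "HOL-Analysis.Analysis"
begin

text \<open>
  For a compact Hausdorff space \<open>'k\<close>, the type \<open>'k \<Rightarrow>\<^sub>C complex\<close> of bounded continuous functions is
  all of \<open>C('k)\<close>, and its library norm is the supremum norm.  The library provides no
  multiplication on this type; the pointwise one is added here.
\<close>

unbundle bcontfun.lifting

instantiation bcontfun :: (topological_space, real_normed_algebra_1) real_normed_algebra_1
begin

lift_definition times_bcontfun :: "('a \<Rightarrow>\<^sub>C 'b) \<Rightarrow> ('a \<Rightarrow>\<^sub>C 'b) \<Rightarrow> 'a \<Rightarrow>\<^sub>C 'b"
  is "\<lambda>f g x. f x * g x"
proof -
  fix f g :: "'a \<Rightarrow> 'b"
  assume f: "f \<in> bcontfun" and g: "g \<in> bcontfun"
  obtain c where c: "\<And>x. norm (f x) \<le> c"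
    using f by (auto simp: bcontfun_def bounded_iff)
  obtain d where d: "\<And>x. norm (g x) \<le> d"
    using g by (auto simp: bcontfun_def bounded_iff)
  show "(\<lambda>x. f x * g x) \<in> bcontfun"
  proof (rule bcontfun_normI)
    show "continuous_on UNIV (\<lambda>x. f x * g x)"
      using f g by (auto simp: bcontfun_def intro!: continuous_intros)
    show "norm (f x * g x) \<le> c * d" for x
      using norm_mult_ineq[of "f x" "g x"] mult_mono'[OF c[of x] d[of x]] by simp
  qed
qed

definition one_bcontfun :: "'a \<Rightarrow>\<^sub>C 'b"
  where "one_bcontfun = const_bcontfun 1"

declare times_bcontfun.rep_eq [simp]

instance
proof
  fix f g h :: "'a \<Rightarrow>\<^sub>C 'b" and r :: real
  show "f * g * h = f * (g * h)" "(f + g) * h = f * h + g * h" "f * (g + h) = f * g + f * h"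
    "r *\<^sub>R f * g = r *\<^sub>R (f * g)" "f * r *\<^sub>R g = r *\<^sub>R (f * g)"
    "1 * f = f" "f * 1 = f"
    by (auto intro!: bcontfun_eqI simp: algebra_simps one_bcontfun_def)
  have "apply_bcontfun (0 :: 'a \<Rightarrow>\<^sub>C 'b) undefined \<noteq> apply_bcontfun 1 undefined"
    by (simp add: one_bcontfun_def)
  then show "(0 :: 'a \<Rightarrow>\<^sub>C 'b) \<noteq> 1"
    by metis
  show "norm (f * g) \<le> norm f * norm g"
  proof (rule norm_bound)
    fix x
    have "norm (f x * g x) \<le> norm (f x) * norm (g x)"
      by (rule norm_mult_ineq)
    also have "\<dots> \<le> norm f * norm g"
      by (intro mult_mono norm_bounded) auto
    finally show "norm (apply_bcontfun (f * g) x) \<le> norm f * norm g"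
      by simp
  qed
  show "norm (1 :: 'a \<Rightarrow>\<^sub>C 'b) = 1"
  proof (rule antisym)
    show "norm (1 :: 'a \<Rightarrow>\<^sub>C 'b) \<le> 1"
      by (rule norm_bound) (simp add: one_bcontfun_def)
    show "1 \<le> norm (1 :: 'a \<Rightarrow>\<^sub>C 'b)"
      using norm_bounded[of "1 :: 'a \<Rightarrow>\<^sub>C 'b" undefined] by (simp add: one_bcontfun_def)
  qed
qed

end

lifting_forget bcontfun.lifting

text \<open>The library has no complex vector spaces, so complex scalar multiplication is written as
  multiplication by a constant function.\<close>

definition cscale :: "complex \<Rightarrow> ('k::topological_space \<Rightarrow>\<^sub>C complex) \<Rightarrow> 'k \<Rightarrow>\<^sub>C complex"
  where "cscale c f = const_bcontfun c * f"

lemma apply_cscale [simp]: "apply_bcontfun (cscale c f) x = c * apply_bcontfun f x"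
  by (simp add: cscale_def)

definition uniform_algebra :: "('k::t2_space \<Rightarrow>\<^sub>C complex) set \<Rightarrow> bool"
  where "uniform_algebra A \<longleftrightarrow>
    compact (UNIV :: 'k set) \<and>
    closed A \<and>
    (\<forall>f\<in>A. \<forall>g\<in>A. f + g \<in> A) \<and>
    (\<forall>c. \<forall>f\<in>A. cscale c f \<in> A) \<and>
    (\<forall>f\<in>A. \<forall>g\<in>A. f * g \<in> A) \<and>
    (\<forall>c. const_bcontfun c \<in> A) \<and>
    (\<forall>s t. s \<noteq> t \<longrightarrow> (\<exists>f\<in>A. apply_bcontfun f s \<noteq> apply_bcontfun f t))"

text \<open>A map from \<open>A\<close> to \<open>B\<close> is a function on the ambient type of which only the values on \<open>A\<close>
  matter.  All linearity is over the complex numbers.\<close>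

definition linear_map ::
  "('k::topological_space \<Rightarrow>\<^sub>C complex) set \<Rightarrow> ('l::topological_space \<Rightarrow>\<^sub>C complex) set \<Rightarrow>
    (('k \<Rightarrow>\<^sub>C complex) \<Rightarrow> ('l \<Rightarrow>\<^sub>C complex)) \<Rightarrow> bool"
  where "linear_map A B T \<longleftrightarrow>
    T \<in> A \<rightarrow> B \<and>
    (\<forall>f\<in>A. \<forall>g\<in>A. T (f + g) = T f + T g) \<and>
    (\<forall>c. \<forall>f\<in>A. T (cscale c f) = cscale c (T f))"

definition Iso ::
  "('k::topological_space \<Rightarrow>\<^sub>C complex) set \<Rightarrow> ('l::topological_space \<Rightarrow>\<^sub>C complex) set \<Rightarrow>
    (('k \<Rightarrow>\<^sub>C complex) \<Rightarrow> ('l \<Rightarrow>\<^sub>C complex)) set"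
  where "Iso A B = {T. linear_map A B T \<and>
    (\<forall>f\<in>A. \<forall>g\<in>A. dist (T f) (T g) = dist f g) \<and> T ` A = B}"

definition alg_isos ::
  "('k::topological_space \<Rightarrow>\<^sub>C complex) set \<Rightarrow> ('l::topological_space \<Rightarrow>\<^sub>C complex) set \<Rightarrow>
    (('k \<Rightarrow>\<^sub>C complex) \<Rightarrow> ('l \<Rightarrow>\<^sub>C complex)) set"
  where "alg_isos A B = {T. linear_map A B T \<and>
    (\<forall>f\<in>A. \<forall>g\<in>A. T (f * g) = T f * T g) \<and> bij_betw T A B}"

definition two_local_isometry ::
  "('k::topological_space \<Rightarrow>\<^sub>C complex) set \<Rightarrow> ('l::topological_space \<Rightarrow>\<^sub>C complex) set \<Rightarrow>
    (('k \<Rightarrow>\<^sub>C complex) \<Rightarrow> ('l \<Rightarrow>\<^sub>C complex)) \<Rightarrow> bool"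
  where "two_local_isometry A B \<Delta> \<longleftrightarrow>
    \<Delta> \<in> A \<rightarrow> B \<and> (\<forall>x\<in>A. \<forall>y\<in>A. \<exists>T\<in>Iso A B. \<Delta> x = T x \<and> \<Delta> y = T y)"

definition two_local_isomorphism ::
  "('k::topological_space \<Rightarrow>\<^sub>C complex) set \<Rightarrow> ('l::topological_space \<Rightarrow>\<^sub>C complex) set \<Rightarrow>
    (('k \<Rightarrow>\<^sub>C complex) \<Rightarrow> ('l \<Rightarrow>\<^sub>C complex)) \<Rightarrow> bool"
  where "two_local_isomorphism A B \<Delta> \<longleftrightarrow>
    \<Delta> \<in> A \<rightarrow> B \<and> (\<forall>x\<in>A. \<forall>y\<in>A. \<exists>T\<in>alg_isos A B. \<Delta> x = T x \<and> \<Delta> y = T y)"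

definition local_isometry ::
  "('k::topological_space \<Rightarrow>\<^sub>C complex) set \<Rightarrow> ('l::topological_space \<Rightarrow>\<^sub>C complex) set \<Rightarrow>
    (('k \<Rightarrow>\<^sub>C complex) \<Rightarrow> ('l \<Rightarrow>\<^sub>C complex)) \<Rightarrow> bool"
  where "local_isometry A B \<Delta> \<longleftrightarrow>
    linear_map A B \<Delta> \<and> (\<forall>x\<in>A. \<exists>T\<in>Iso A B. \<Delta> x = T x)"

definition local_isomorphism ::
  "('k::topological_space \<Rightarrow>\<^sub>C complex) set \<Rightarrow> ('l::topological_space \<Rightarrow>\<^sub>C complex) set \<Rightarrow>
    (('k \<Rightarrow>\<^sub>C complex) \<Rightarrow> ('l \<Rightarrow>\<^sub>C complex)) \<Rightarrow> bool"
  where "local_isomorphism A B \<Delta> \<longleftrightarrow>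
    linear_map A B \<Delta> \<and> (\<forall>x\<in>A. \<exists>T\<in>alg_isos A B. \<Delta> x = T x)"

end

theory Submission
  imports Defs "HOL-Complex_Analysis.Complex_Analysis"
begin

text \<open>
  Algebra isomorphisms between uniform algebras are isometric, so everything reduces to the
  additivity of a 2-local isometry \<open>\<Delta>\<close>, and it suffices to check it at the points \<open>t\<close> of a minimal
  closed norming set of \<open>B\<close>.  There a surjective isometry \<open>T\<close> satisfies \<open>\<bar>(T w) t\<bar> \<ge> min \<bar>w\<bar>\<close>, so
  \<open>F x = (\<Delta> x) t\<close> satisfies \<open>min \<bar>x - y\<bar> \<le> \<bar>F x - F y\<bar> \<le> max \<bar>x - y\<bar>\<close>.

  Functionals with these bounds form a compact class that is invariant under translation and
  rescaling.  A real linear member of the class is complex linear, by Liouville's theorem.  If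
  some member were not holomorphic along a complex line, a contour integral over a parallelogram
  would have nonzero supremum over the class.  By scaling, the supremum is attained simultaneously at
  all positions and all small scales, and a further blow-up of this kind in all real directions
  yields a real linear member with nonzero contour integral, a contradiction.  So \<open>F\<close>
  is holomorphic along complex lines, and \<open>F (x + z g) - F (z g)\<close>, being bounded and entire in \<open>z\<close>,
  is constant.
  Compactness of the class thus replaces the almost everywhere differentiability of Lipschitz maps.
\<close>

section \<open>Extremal members of self-similar compact classes\<close>

lemma compact_imp_closed_fun:
  fixes C :: "('a \<Rightarrow> 'b::metric_space) set"
  assumes "compact C"
  shows "closed C"
proof -
  have "Hausdorff_space (euclidean :: ('a \<Rightarrow> 'b) topology)"
    unfolding euclidean_product_topology[symmetric]
    by (rule Hausdorff_space_product_topology[THEN iffD2]) simp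
  then show ?thesis
    using assms compactin_imp_closedin by fastforce
qed

text \<open>Tychonoff's theorem: the set is a product of closed balls.\<close>

lemma compact_product_cball:
  "compact {f :: 'a \<Rightarrow> 'b::heine_borel. \<forall>x. dist (a x) (f x) \<le> r x}"
proof -
  have "compactin (product_topology (\<lambda>_. euclidean) UNIV) (PiE UNIV (\<lambda>x. cball (a x) (r x)))"
    by (subst compactin_PiE) auto
  moreover have "PiE UNIV (\<lambda>x. cball (a x) (r x)) = {f. \<forall>x. dist (a x) (f x) \<le> r x}"
    by (auto simp: PiE_UNIV_domain)
  ultimately show ?thesis
    by (simp add: euclidean_product_topology)
qed

text \<open>A blow-up of \<open>G\<close> at \<open>a\<close>. The value 0 off \<open>A\<close>
  leaves one representative of each functional on \<open>A\<close>, so that classes of such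
  functionals can be compact as sets of functions on the whole type.\<close>

definition rescale :: "'a::real_vector set \<Rightarrow> 'a \<Rightarrow> real \<Rightarrow> ('a \<Rightarrow> complex) \<Rightarrow> 'a \<Rightarrow> complex"
  where "rescale A a r G = (\<lambda>x. if x \<in> A then (G (a + r *\<^sub>R x) - G a) /\<^sub>R r else 0)"

lemma rescale_rescale:
  assumes "subspace A" "a \<in> A"
  shows "rescale A a r (rescale A b s G) = rescale A (b + s *\<^sub>R a) (r * s) G"
proof
  fix x
  have "a + r *\<^sub>R x \<in> A" if "x \<in> A"
    using assms that by (simp add: subspace_add subspace_mul)
  moreover have "b + s *\<^sub>R (a + r *\<^sub>R x) = b + s *\<^sub>R a + (r * s) *\<^sub>R x"
    by (simp add: scaleR_add_right mult.commute)
  ultimately show "rescale A a r (rescale A b s G) x = rescale A (b + s *\<^sub>R a) (r * s) G x"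
    using assms(2) by (simp add: rescale_def add.assoc flip: scaleR_diff_right)
qed

lemma continuous_on_rescale: "continuous_on C (rescale A a r)"
proof (rule continuous_on_coordinatewise_then_product)
  fix x
  have "continuous_on C (\<lambda>G. (G (a + r *\<^sub>R x) - G a) /\<^sub>R r)"
    by (intro continuous_intros continuous_on_subset[OF continuous_on_product_coordinates]) auto
  then show "continuous_on C (\<lambda>G. rescale A a r G x)"
    by (cases "x \<in> A") (simp_all add: rescale_def)
qed

text \<open>Scales are dyadic because each averaging identity below halves the scale, and
  extremality spreads from one scale to the next by this factor.\<close>

definition self_similar :: "'a::real_normed_vector set \<Rightarrow> ('a \<Rightarrow> complex) set \<Rightarrow> bool"
  where "self_similar A C \<longleftrightarrow> compact C \<and> C \<noteq> {} \<and>
    (\<forall>G\<in>C. G 0 = 0 \<and> continuous_on A G \<and> (\<forall>x. x \<notin> A \<longrightarrow> G x = 0)) \<and>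
    (\<forall>G\<in>C. \<forall>a\<in>A. \<forall>n::nat. rescale A a ((1/2) ^ n) G \<in> C)"

lemma self_similarD:
  assumes "self_similar A C"
  shows "compact C" "C \<noteq> {}" "G \<in> C \<Longrightarrow> G 0 = 0" "G \<in> C \<Longrightarrow> continuous_on A G"
    "G \<in> C \<Longrightarrow> x \<notin> A \<Longrightarrow> G x = 0"
    "G \<in> C \<Longrightarrow> a \<in> A \<Longrightarrow> rescale A a ((1/2) ^ n) G \<in> C"
    "G \<in> C \<Longrightarrow> a \<in> A \<Longrightarrow> rescale A a (1/2) G \<in> C"
    "G \<in> C \<Longrightarrow> a \<in> A \<Longrightarrow> rescale A a 1 G \<in> C"
    "G \<in> C \<Longrightarrow> rescale A 0 1 G = G"
proof -
  show "G \<in> C \<Longrightarrow> a \<in> A \<Longrightarrow> rescale A a (1/2) G \<in> C"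
    using assms unfolding self_similar_def by (metis power_one_right)
  show "G \<in> C \<Longrightarrow> a \<in> A \<Longrightarrow> rescale A a 1 G \<in> C"
    using assms unfolding self_similar_def by (metis power_0)
  show "G \<in> C \<Longrightarrow> rescale A 0 1 G = G"
    using assms unfolding self_similar_def by (auto simp: rescale_def)
qed (use assms in \<open>auto simp: self_similar_def\<close>)

text \<open>Blow-ups compose to blow-ups with base points in \<open>A\<close> and dyadic scales, so
  they inherit the condition. For fixed \<open>a\<close> and \<open>n\<close> it is closed in
  \<open>C\<close>, which keeps the subclass compact.\<close>

lemma self_similar_subset:
  assumes C: "self_similar A C" and J: "continuous_on C J" and A: "subspace A"
    and ne: "\<exists>G\<in>C. \<forall>a\<in>A. \<forall>n. J (rescale A a ((1/2) ^ n) G) = (c::real)"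
  shows "self_similar A {G \<in> C. \<forall>a\<in>A. \<forall>n. J (rescale A a ((1/2) ^ n) G) = c}"
    (is "self_similar A ?C'")
proof -
  have cl: "closed C"
    using C compact_imp_closed_fun self_similarD(1) by blast
  have cont: "continuous_on C (\<lambda>G. J (rescale A a ((1/2) ^ n) G))" if "a \<in> A" for a n
    by (rule continuous_on_compose2[OF J continuous_on_rescale])
      (use self_similarD(6)[OF C] that in auto)
  have "?C' = C \<inter> (\<Inter>a\<in>A. \<Inter>n. C \<inter> (\<lambda>G. J (rescale A a ((1/2) ^ n) G)) -` {c})"
    by auto
  moreover have "closed (\<Inter>a\<in>A. \<Inter>n. C \<inter> (\<lambda>G. J (rescale A a ((1/2) ^ n) G)) -` {c})"
    by (intro closed_INT ballI continuous_closed_preimage cont cl) auto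
  ultimately have "compact ?C'"
    using compact_Int_closed[OF self_similarD(1)[OF C]] by auto
  moreover have "rescale A a ((1/2) ^ n) G \<in> ?C'" if "G \<in> ?C'" "a \<in> A" for G a n
    using that self_similarD(6)[OF C]
    by (auto simp: rescale_rescale[OF A] power_add[symmetric] A subspace_add subspace_mul)
  ultimately show ?thesis
    using ne C unfolding self_similar_def by auto
qed

text \<open>Zooming in cannot increase an averaged functional beyond its supremum \<open>c\<close>, while zooming out
  makes any finite set of translates look like a single one.  Hence the value \<open>c\<close> is nearly attained
  at finitely many prescribed positions simultaneously, and compactness gives all of them.\<close>

lemma self_similar_extremal:
  assumes A: "subspace A" and C: "self_similar A C" and J: "continuous_on C J"
    and N: "N > 0" and off: "\<And>i::nat. i < N \<Longrightarrow> off i \<in> A" and off0: "off 0 = 0"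
    and avg: "\<And>G. G \<in> C \<Longrightarrow> real N * J G = (\<Sum>i<N. J (rescale A (off i) (1/2) G))"
    and G1: "G1 \<in> C"
  obtains c where "J G1 \<le> c"
    "self_similar A {G \<in> C. \<forall>a\<in>A. \<forall>n. J (rescale A a ((1/2) ^ n) G) = c}"
proof -
  note CD = self_similarD[OF C]
  obtain G0 where G0: "G0 \<in> C" and max: "\<And>G. G \<in> C \<Longrightarrow> J G \<le> J G0"
    using continuous_attains_sup[OF CD(1,2) J] by blast
  define c where "c = J G0"
  \<comment> \<open>By \<open>avg\<close> the sum for \<open>G\<close> is the mean of the
    corresponding sums for the half-scale blow-ups \<open>H i\<close>, so some \<open>H i\<close>
    does at least as well. Passing to it doubles the shifts, and \<open>n\<close> repetitions turn
    \<open>y /\<^sub>R 2 ^ n\<close> into \<open>y\<close>.\<close>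
  have zoom: "\<exists>G'\<in>C. (\<Sum>y\<in>Y. J (rescale A (y /\<^sub>R 2 ^ n) 1 G)) \<le> (\<Sum>y\<in>Y. J (rescale A y 1 G'))"
    if "G \<in> C" "Y \<subseteq> A" for G Y n
    using that
  proof (induction n arbitrary: G)
    case 0
    then show ?case by auto
  next
    case (Suc n)
    define s where "s = (\<lambda>G n. \<Sum>y\<in>Y. J (rescale A (y /\<^sub>R 2 ^ n) 1 G))"
    define H where "H = (\<lambda>i. rescale A (off i) (1/2) G)"
    have H: "H i \<in> C" if "i < N" for i
      using CD(7) off Suc.prems that by (auto simp: H_def)
    have yA: "y /\<^sub>R 2 ^ k \<in> A" if "y \<in> Y" for y k
      using A Suc.prems that by (auto simp: subspace_mul)
    have "real N * s G (Suc n) = (\<Sum>y\<in>Y. real N * J (rescale A (y /\<^sub>R 2 ^ Suc n) 1 G))"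
      by (simp add: s_def sum_distrib_left)
    also have "\<dots> = (\<Sum>y\<in>Y. \<Sum>i<N. J (rescale A (y /\<^sub>R 2 ^ n) 1 (H i)))"
    proof (rule sum.cong[OF refl])
      fix y assume y: "y \<in> Y"
      have "real N * J (rescale A (y /\<^sub>R 2 ^ Suc n) 1 G) =
          (\<Sum>i<N. J (rescale A (off i) (1/2) (rescale A (y /\<^sub>R 2 ^ Suc n) 1 G)))"
        by (intro avg CD(8) Suc.prems yA y)
      also have "\<dots> = (\<Sum>i<N. J (rescale A (y /\<^sub>R 2 ^ n) 1 (H i)))"
        by (intro sum.cong refl arg_cong[where f = J])
          (use off yA y in \<open>simp add: H_def rescale_rescale[OF A] add.commute\<close>)
      finally show "real N * J (rescale A (y /\<^sub>R 2 ^ Suc n) 1 G) =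
          (\<Sum>i<N. J (rescale A (y /\<^sub>R 2 ^ n) 1 (H i)))" .
    qed
    also have "\<dots> = (\<Sum>i<N. s (H i) n)"
      by (subst sum.swap) (simp add: s_def)
    finally have eq: "real N * s G (Suc n) = (\<Sum>i<N. s (H i) n)" .
    have "\<exists>i<N. s G (Suc n) \<le> s (H i) n"
    proof (rule ccontr)
      assume "\<not> ?thesis"
      then have "(\<Sum>i<N. s (H i) n) < (\<Sum>i<N. s G (Suc n))"
        using N by (intro sum_strict_mono) auto
      with eq show False by simp
    qed
    then obtain i where i: "i < N" "s G (Suc n) \<le> s (H i) n" by blast
    obtain G' where "G' \<in> C" "s (H i) n \<le> (\<Sum>y\<in>Y. J (rescale A y 1 G'))"
      using Suc.IH[OF H[OF i(1)]] Suc.prems unfolding s_def by blast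
    with i(2) show ?case
      unfolding s_def by (meson order_trans)
  qed
  \<comment> \<open>For large \<open>n\<close> the slightly shifted copies of the maximiser
    \<open>G0\<close> are close to \<open>G0\<close>, so the left-hand sum in \<open>zoom\<close>
    nearly equals \<open>card Y\<close> times \<open>c\<close>. No summand for the resulting
    \<open>G\<close> exceeds \<open>c\<close>, hence none can fall short of \<open>c\<close> by more
    than \<open>e\<close>.\<close>
  have fin: "\<exists>G\<in>C. \<forall>y\<in>Y. J (rescale A y 1 G) \<ge> c - e"
    if Y: "finite Y" "Y \<subseteq> A" and e: "e > 0" for Y e
  proof -
    have lim: "(\<lambda>n. J (rescale A (y /\<^sub>R 2 ^ n) 1 G0)) \<longlonglongrightarrow> c" if y: "y \<in> Y" for y
    proof -
      have yA: "y /\<^sub>R 2 ^ n \<in> A" for n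
        using A Y y by (auto simp: subspace_mul)
      have "(\<lambda>n. (1/2) ^ n :: real) \<longlonglongrightarrow> 0"
        by (rule LIMSEQ_power_zero) simp
      then have y0: "(\<lambda>n. y /\<^sub>R 2 ^ n) \<longlonglongrightarrow> 0"
        using tendsto_scaleR[of "\<lambda>n. (1/2) ^ n :: real" 0 sequentially "\<lambda>_. y" y]
        by (simp add: power_divide inverse_eq_divide)
      have G0lim: "(\<lambda>n. G0 (z n)) \<longlonglongrightarrow> G0 w" if "\<And>n. z n \<in> A" "w \<in> A" "z \<longlonglongrightarrow> w" for z w
        using continuous_on_tendsto_compose[OF CD(4)[OF G0] that(3,2)] that(1) by simp
      have coord: "(\<lambda>n. rescale A (y /\<^sub>R 2 ^ n) 1 G0 x) \<longlonglongrightarrow> G0 x" for x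
      proof (cases "x \<in> A")
        case True
        have "(\<lambda>n. G0 (y /\<^sub>R 2 ^ n + x)) \<longlonglongrightarrow> G0 (0 + x)"
          by (intro G0lim tendsto_intros y0) (use A yA True in \<open>auto simp: subspace_add\<close>)
        moreover have "(\<lambda>n. G0 (y /\<^sub>R 2 ^ n)) \<longlonglongrightarrow> G0 0"
          by (intro G0lim y0 yA subspace_0 A)
        ultimately have "(\<lambda>n. G0 (y /\<^sub>R 2 ^ n + x) - G0 (y /\<^sub>R 2 ^ n)) \<longlonglongrightarrow> G0 (0 + x) - G0 0"
          by (rule tendsto_diff)
        then show ?thesis
          using True CD(3)[OF G0] by (simp add: rescale_def)
      next
        case False
        then show ?thesis
          using CD(5)[OF G0] by (simp add: rescale_def)
      qed
      have "(\<lambda>n. rescale A (y /\<^sub>R 2 ^ n) 1 G0) \<longlonglongrightarrow> G0"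
        using coord limitin_componentwise[of "\<lambda>_. euclidean" UNIV "\<lambda>n. rescale A (y /\<^sub>R 2 ^ n) 1 G0" G0 sequentially]
        by (simp add: euclidean_product_topology)
      then show ?thesis
        unfolding c_def
        by (rule continuous_on_tendsto_compose[OF J _ G0])
          (use CD(8)[OF G0] yA in auto)
    qed
    have "(\<lambda>n. \<Sum>y\<in>Y. J (rescale A (y /\<^sub>R 2 ^ n) 1 G0)) \<longlonglongrightarrow> (\<Sum>y\<in>Y. c)"
      by (intro tendsto_sum lim)
    then have "\<forall>\<^sub>F n in sequentially. (\<Sum>y\<in>Y. c) - e < (\<Sum>y\<in>Y. J (rescale A (y /\<^sub>R 2 ^ n) 1 G0))"
      using e by (intro order_tendstoD(1)) auto
    then obtain n where n: "(\<Sum>y\<in>Y. c) - e < (\<Sum>y\<in>Y. J (rescale A (y /\<^sub>R 2 ^ n) 1 G0))"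
      by (meson eventually_sequentially le_refl)
    obtain G where G: "G \<in> C" "(\<Sum>y\<in>Y. c) - e < (\<Sum>y\<in>Y. J (rescale A y 1 G))"
      using zoom[OF G0 Y(2), of n] n by fastforce
    have le: "J (rescale A y 1 G) \<le> c" if "y \<in> Y" for y
      using max CD(8)[OF G(1)] that Y(2) by (auto simp: c_def)
    have "J (rescale A y 1 G) \<ge> c - e" if y: "y \<in> Y" for y
    proof -
      have "c - J (rescale A y 1 G) \<le> (\<Sum>y\<in>Y. c - J (rescale A y 1 G))"
        by (rule member_le_sum) (use y le Y(1) in auto)
      also have "\<dots> < e"
        using G(2) unfolding sum_subtractf by linarith
      finally show ?thesis by simp
    qed
    with G(1) show ?thesis by blast
  qed
  \<comment> \<open>Indexing by pairs of a position and a tolerance lets the finite intersection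
    property turn the approximate solutions into one exact solution.\<close>
  define K where "K = (\<lambda>(y,e). C \<inter> (\<lambda>G. J (rescale A y 1 G)) -` {c - e..})"
  have "C \<inter> (\<Inter>p\<in>A \<times> {0<..}. K p) \<noteq> {}"
  proof (rule compact_imp_fip_image[OF CD(1)])
    show "closed (K p)" if "p \<in> A \<times> {0<..}" for p
    proof -
      have "continuous_on C (\<lambda>G. J (rescale A (fst p) 1 G))"
        by (rule continuous_on_compose2[OF J continuous_on_rescale]) (use that CD(8) in auto)
      then show ?thesis
        unfolding K_def case_prod_beta
        by (intro continuous_closed_preimage compact_imp_closed_fun CD(1)) auto
    qed
    fix P :: "('a \<times> real) set" assume P: "finite P" "P \<subseteq> A \<times> {0<..}"
    \<comment> \<open>The inserted 1 provides a positive minimum when \<open>P\<close> is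
      empty.\<close>
    define e where "e = Min (insert 1 (snd ` P))"
    have e: "e > 0" "\<And>p. p \<in> P \<Longrightarrow> e \<le> snd p"
      using P by (auto simp: e_def)
    obtain G where "G \<in> C" "\<forall>y\<in>fst ` P. J (rescale A y 1 G) \<ge> c - e"
      using fin[OF _ _ e(1), of "fst ` P"] P by force
    then have "G \<in> C \<inter> (\<Inter>p\<in>P. K p)"
      using e(2) by (fastforce simp: K_def)
    then show "C \<inter> (\<Inter>p\<in>P. K p) \<noteq> {}" by blast
  qed
  then obtain G where G: "G \<in> C" and Ge: "\<And>y e. y \<in> A \<Longrightarrow> e > 0 \<Longrightarrow> c - e \<le> J (rescale A y 1 G)"
    unfolding K_def by fastforce
  \<comment> \<open>At scale 1 maximality gives equality. Then the mean of \<open>N\<close> values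
    that are at most \<open>c\<close> equals \<open>c\<close>, so all of them equal
    \<open>c\<close>; because \<open>off 0 = 0\<close>, one of them belongs to the next smaller
    scale at the same centre.\<close>
  have scales: "J (rescale A a ((1/2) ^ n) G) = c" if "a \<in> A" for a n
    using that
  proof (induction n arbitrary: a)
    case 0
    have "c \<le> J (rescale A a 1 G)"
      using Ge[OF 0] by (meson diff_le_eq field_le_epsilon)
    then show ?case
      using max[OF CD(8)[OF G 0]] by (simp add: c_def)
  next
    case (Suc n)
    let ?H = "rescale A a ((1/2) ^ n) G"
    have H: "?H \<in> C" using CD(6) G Suc.prems by blast
    have le: "J (rescale A (off i) (1/2) ?H) \<le> c" if "i < N" for i
      unfolding c_def by (intro max CD(7) H off that)
    have "(\<Sum>i<N. J (rescale A (off i) (1/2) ?H)) = (\<Sum>i<N. c)"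
      using avg[OF H] Suc by simp
    then have "J (rescale A (off 0) (1/2) ?H) = c"
      using sum_mono_inv[of "\<lambda>i. J (rescale A (off i) (1/2) ?H)" "{..<N}" "\<lambda>_. c" 0] le N by simp
    then show ?case
      using A by (simp add: rescale_rescale[OF A] off0 subspace_0)
  qed
  show ?thesis
    using that[of c] self_similar_subset[OF C J A] scales G max[OF G1] c_def by blast
qed

text \<open>For one \<open>v\<close>, extremality is applied to the real and then the imaginary part
  of \<open>G v\<close>, which is the mean of the doubled increments over the two halves of the
  segment from 0 to \<open>v\<close>. Extremal members have the same increment over \<open>v\<close>
  at every base point. Nested subclasses treat finitely many \<open>v\<close>, and compactness
  treats all of them.\<close>

lemma self_similar_additive:
  assumes A: "subspace A" and C: "self_similar A C"
  shows "\<exists>D\<in>C. \<forall>a\<in>A. \<forall>v\<in>A. D (a + v) = D a + D v"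
proof -
  have part: "\<exists>C'. C' \<subseteq> C \<and> self_similar A C' \<and> (\<forall>G\<in>C'. \<forall>a\<in>A. p (G (a + v)) = p (G a) + p (G v))"
    if C: "self_similar A C" and v: "v \<in> A" and p: "bounded_linear p" for C v and p :: "complex \<Rightarrow> real"
  proof -
    interpret p: bounded_linear p by (rule p)
    note CD = self_similarD[OF C]
    define off where "off = (\<lambda>i::nat. if i = 0 then 0 else v /\<^sub>R 2)"
    have off: "off i \<in> A" for i
      using A v by (auto simp: off_def subspace_0 subspace_mul)
    have cont: "continuous_on C (\<lambda>G. p (G v))"
      by (intro p.continuous_on continuous_on_subset[OF continuous_on_product_coordinates subset_UNIV])
    have avg: "real 2 * p (G v) = (\<Sum>i<2. p (rescale A (off i) (1/2) G v))" if "G \<in> C" for G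
      using CD(3)[OF that] v
      by (simp add: rescale_def off_def numeral_2_eq_2 p.scaleR p.diff p.zero
          scaleR_add_left[symmetric] inverse_eq_divide flip: p.add)
    obtain G1 where "G1 \<in> C" using CD(2) by blast
    then obtain c where c: "self_similar A {G \<in> C. \<forall>a\<in>A. \<forall>n. p (rescale A a ((1/2) ^ n) G v) = c}"
      using self_similar_extremal[OF A C cont _ off _ avg] by (auto simp: off_def)
    have "p (G (a + v)) = p (G a) + p (G v)"
      if "G \<in> C" "\<forall>a\<in>A. \<forall>n::nat. p (rescale A a ((1/2) ^ n) G v) = c" "a \<in> A" for G a
    proof -
      have "p (G (b + v)) - p (G b) = c" if "b \<in> A" for b
        using \<open>\<forall>a\<in>A. _ a\<close>[rule_format, OF that, of 0] v by (simp add: rescale_def p.diff)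
      from this[of a] this[of 0] show ?thesis
        using that CD(3)[OF that(1)] A by (simp add: subspace_0 p.zero)
    qed
    then show ?thesis
      by (intro exI[of _ "{G \<in> C. \<forall>a\<in>A. \<forall>n. p (rescale A a ((1/2) ^ n) G v) = c}"]) (use c in blast)
  qed
  have step: "\<exists>C'. C' \<subseteq> C \<and> self_similar A C' \<and> (\<forall>G\<in>C'. \<forall>a\<in>A. G (a + v) = G a + G v)"
    if C: "self_similar A C" and v: "v \<in> A" for C v
  proof -
    obtain C1 where C1: "C1 \<subseteq> C" "self_similar A C1"
      "\<forall>G\<in>C1. \<forall>a\<in>A. Re (G (a + v)) = Re (G a) + Re (G v)"
      using part[OF C v bounded_linear_Re] by blast
    obtain C2 where C2: "C2 \<subseteq> C1" "self_similar A C2"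
      "\<forall>G\<in>C2. \<forall>a\<in>A. Im (G (a + v)) = Im (G a) + Im (G v)"
      using part[OF C1(2) v bounded_linear_Im] by blast
    show ?thesis
      using C1 C2 by (intro exI[of _ C2]) (auto simp: complex_eq_iff subset_iff)
  qed
  have fin: "\<exists>C'\<subseteq>C. self_similar A C' \<and> (\<forall>G\<in>C'. \<forall>v\<in>V. \<forall>a\<in>A. G (a + v) = G a + G v)"
    if "finite V" "V \<subseteq> A" for V
    using that
  proof (induction V)
    case empty
    then show ?case using C by auto
  next
    case (insert v V)
    then obtain C1 where C1: "C1 \<subseteq> C" "self_similar A C1"
      "\<forall>G\<in>C1. \<forall>v\<in>V. \<forall>a\<in>A. G (a + v) = G a + G v" by auto
    obtain C2 where "C2 \<subseteq> C1" "self_similar A C2" "\<forall>G\<in>C2. \<forall>a\<in>A. G (a + v) = G a + G v"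
      using step[OF C1(2), of v] insert.prems by auto
    with C1 show ?case
      by (intro exI[of _ C2]) blast
  qed
  have "C \<inter> (\<Inter>v\<in>A. {G. \<forall>a\<in>A. G (a + v) = G a + G v}) \<noteq> {}"
  proof (rule compact_imp_fip_image[OF self_similarD(1)[OF C]])
    show "closed {G::_ \<Rightarrow> complex. \<forall>a\<in>A. G (a + v) = G a + G v}" for v
      unfolding Collect_ball_eq
      by (intro closed_INT ballI closed_Collect_eq continuous_on_add continuous_on_product_coordinates)
    fix V assume "finite V" "V \<subseteq> A"
    then obtain C' where "C' \<subseteq> C" "self_similar A C'" "\<forall>G\<in>C'. \<forall>v\<in>V. \<forall>a\<in>A. G (a + v) = G a + G v"
      using fin by metis
    then show "C \<inter> (\<Inter>v\<in>V. {G. \<forall>a\<in>A. G (a + v) = G a + G v}) \<noteq> {}"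
      using self_similarD(2) by blast
  qed
  then show ?thesis by blast
qed

section \<open>Complex linearity of additive limits\<close>

lemma apply_bcontfun_one [simp]:
  "apply_bcontfun (1 :: 'k::topological_space \<Rightarrow>\<^sub>C 'b::real_normed_algebra_1) s = 1"
  by (simp add: one_bcontfun_def)

lemma apply_bcontfun_power [simp]:
  "apply_bcontfun (f ^ n) s = apply_bcontfun f s ^ n"
  for f :: "'k::topological_space \<Rightarrow>\<^sub>C 'b::real_normed_algebra_1"
  by (induction n) auto

lemma apply_bcontfun_sum [simp]:
  "apply_bcontfun (\<Sum>i\<in>I. f i) s = (\<Sum>i\<in>I. apply_bcontfun (f i) s)"
  for f :: "'i \<Rightarrow> 'k::topological_space \<Rightarrow>\<^sub>C 'b::real_normed_vector"
  by (induction I rule: infinite_finite_induct) auto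

lemma scaleR_eq_cscale: "r *\<^sub>R f = cscale (of_real r) f"
  by (rule bcontfun_eqI) (simp add: complex_eq_iff)

lemma norm_cscale: "norm (cscale c f) \<le> cmod c * norm f"
  by (rule norm_bound) (simp add: norm_mult mult_left_mono norm_bounded)

lemma uniform_algebraD:
  assumes "uniform_algebra (A :: ('k::t2_space \<Rightarrow>\<^sub>C complex) set)"
  shows "compact (UNIV :: 'k set)" "closed A" "f \<in> A \<Longrightarrow> g \<in> A \<Longrightarrow> f + g \<in> A"
    "f \<in> A \<Longrightarrow> cscale c f \<in> A" "f \<in> A \<Longrightarrow> g \<in> A \<Longrightarrow> f * g \<in> A" "const_bcontfun c \<in> A"
    "subspace A" "f \<in> A \<Longrightarrow> g \<in> A \<Longrightarrow> f - g \<in> A" "1 \<in> A" "f \<in> A \<Longrightarrow> f ^ n \<in> A"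
proof -
  note A = assms[unfolded uniform_algebra_def]
  show one: "1 \<in> A"
    using A by (auto simp: one_bcontfun_def)
  show "f \<in> A \<Longrightarrow> f ^ n \<in> A"
    by (induction n) (use A one in auto)
  have "0 \<in> A"
    using A const_bcontfun_0_eq_0 by metis
  then show "subspace A"
    using A by (auto simp: subspace_def scaleR_eq_cscale)
  then show "f \<in> A \<Longrightarrow> g \<in> A \<Longrightarrow> f - g \<in> A"
    by (rule subspace_diff)
qed (use assms in \<open>auto simp: uniform_algebra_def\<close>)

text \<open>The M-test gives uniform convergence, and closedness keeps the limit in
  \<open>A\<close>. Exponentials and the Neumann series below are instances.\<close>

lemma uniform_algebra_power_series:
  assumes A: "uniform_algebra A" and f: "f \<in> A"
    and c: "summable (\<lambda>n. cmod (c n) * norm f ^ n)"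
  obtains y where "y \<in> A" "\<And>s. (\<lambda>n. c n * apply_bcontfun f s ^ n) sums apply_bcontfun y s"
    "(\<lambda>N. \<Sum>n<N. cscale (c n) (f ^ n)) \<longlonglongrightarrow> y"
proof -
  define S where "S = (\<lambda>N. \<Sum>n<N. cscale (c n) (f ^ n))"
  have le: "norm (c n * apply_bcontfun f s ^ n) \<le> cmod (c n) * norm f ^ n" for n s
    by (simp add: norm_mult norm_power mult_left_mono power_mono norm_bounded)
  have "uniform_limit UNIV (\<lambda>N s. \<Sum>n<N. c n * apply_bcontfun f s ^ n)
      (\<lambda>s. \<Sum>n. c n * apply_bcontfun f s ^ n) sequentially"
    by (rule Weierstrass_m_test[OF _ c]) (rule le)
  also have "(\<lambda>N s. \<Sum>n<N. c n * apply_bcontfun f s ^ n) = (\<lambda>N. apply_bcontfun (S N))"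
    by (simp add: S_def fun_eq_iff)
  finally have "uniform_limit UNIV (\<lambda>N. apply_bcontfun (S N)) (\<lambda>s. \<Sum>n. c n * apply_bcontfun f s ^ n) sequentially" .
  then obtain y where y: "(\<lambda>s. \<Sum>n. c n * apply_bcontfun f s ^ n) = apply_bcontfun y" "S \<longlonglongrightarrow> y"
    by (rule uniform_limit_bcontfunE) auto
  have "S N \<in> A" for N
    unfolding S_def
    by (intro subspace_sum uniform_algebraD[OF A] f)
  then have "y \<in> A"
    using closed_sequentially[OF uniform_algebraD(2)[OF A] _ y(2)] by blast
  moreover have "(\<lambda>n. c n * apply_bcontfun f s ^ n) sums apply_bcontfun y s" for s
    unfolding y(1)[symmetric]
    by (intro summable_sums summable_comparison_test[OF _ c]) (use le in auto)
  ultimately show ?thesis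
    using that y(2) unfolding S_def by blast
qed

lemma uniform_algebra_exp:
  assumes A: "uniform_algebra A" and w: "w \<in> A"
  obtains e where "\<And>z. e z \<in> A" "\<And>z s. apply_bcontfun (e z) s = exp (z * apply_bcontfun w s)"
    "\<And>z. (\<lambda>N. \<Sum>n<N. cscale (z ^ n / fact n) (w ^ n)) \<longlonglongrightarrow> e z"
proof -
  have "\<exists>y\<in>A. (\<forall>s. apply_bcontfun y s = exp (z * apply_bcontfun w s)) \<and>
      (\<lambda>N. \<Sum>n<N. cscale (z ^ n / fact n) (w ^ n)) \<longlonglongrightarrow> y" for z
  proof -
    have "summable (\<lambda>n. cmod (z ^ n / fact n) * norm w ^ n)"
      using summable_exp[of "cmod z * norm w"]
      by (simp add: norm_mult norm_inverse norm_power power_mult_distrib divide_inverse mult_ac)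
    then obtain y where y: "y \<in> A"
      "\<And>s. (\<lambda>n. z ^ n / fact n * apply_bcontfun w s ^ n) sums apply_bcontfun y s"
      "(\<lambda>N. \<Sum>n<N. cscale (z ^ n / fact n) (w ^ n)) \<longlonglongrightarrow> y"
      by (rule uniform_algebra_power_series[OF A w]) (rule that)
    have "apply_bcontfun y s = exp (z * apply_bcontfun w s)" for s
    proof (rule sums_unique2[OF y(2)])
      show "(\<lambda>n. z ^ n / fact n * apply_bcontfun w s ^ n) sums exp (z * apply_bcontfun w s)"
        using exp_converges[of "z * apply_bcontfun w s"]
        by (simp add: power_mult_distrib scaleR_conv_of_real divide_inverse mult_ac)
    qed
    with y show ?thesis by blast
  qed
  then show ?thesis
    using that by metis
qed

text \<open>A bounded linear \<open>L\<close> passes through the exponential series, so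
  \<open>L (e z)\<close> is an everywhere convergent power series in \<open>z\<close> with
  coefficients \<open>L (w ^ n) / fact n\<close>, the first-order one being
  \<open>L w\<close>.\<close>

lemma functional_exp:
  assumes A: "uniform_algebra A" and w: "w \<in> A"
    and e: "\<And>z. e z \<in> A" "\<And>z. (\<lambda>N. \<Sum>n<N. cscale (z ^ n / fact n) (w ^ n)) \<longlonglongrightarrow> e z"
    and add: "\<And>x y. x \<in> A \<Longrightarrow> y \<in> A \<Longrightarrow> L (x + y) = L x + L y"
    and scale: "\<And>c x. x \<in> A \<Longrightarrow> L (cscale c x) = c * L x"
    and bound: "\<And>x. x \<in> A \<Longrightarrow> cmod (L x) \<le> K * norm x"
  shows "(\<lambda>z. L (e z)) holomorphic_on UNIV" "((\<lambda>z. L (e z)) has_field_derivative L w) (at 0)"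
proof -
  note AD = uniform_algebraD[OF A]
  define a where "a = (\<lambda>n. L (w ^ n) / fact n)"
  have L0: "L 0 = 0"
    using scale[OF subspace_0[OF AD(7)], of 0] by (simp add: cscale_def)
  have diff: "L x - L y = L (x - y)" if "x \<in> A" "y \<in> A" for x y
    using add[of "x - y" y] AD(8)[OF that] that by simp
  have sums: "(\<lambda>n. a n * z ^ n) sums L (e z)" for z
  proof -
    define S where "S = (\<lambda>N. \<Sum>n<N. cscale (z ^ n / fact n) (w ^ n))"
    have S: "S N \<in> A" for N
      unfolding S_def by (intro subspace_sum AD w)
    have LS: "L (S N) = (\<Sum>n<N. a n * z ^ n)" for N
    proof (induction N)
      case 0
      then show ?case by (simp add: S_def L0)
    next
      case (Suc N)
      have "L (S (Suc N)) = L (S N) + L (cscale (z ^ N / fact N) (w ^ N))"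
        using S[of N] by (simp add: S_def add AD w)
      with Suc show ?case
        by (simp add: scale AD w a_def)
    qed
    have "(\<lambda>N. norm (S N - e z)) \<longlonglongrightarrow> 0"
      using e(2)[of z] by (simp add: S_def tendsto_norm_zero LIM_zero)
    then have "(\<lambda>N. K * norm (S N - e z)) \<longlonglongrightarrow> 0"
      by (rule tendsto_mult_right_zero)
    then have "(\<lambda>N. L (S N) - L (e z)) \<longlonglongrightarrow> 0"
      by (rule Lim_null_comparison[rotated])
        (use bound[OF AD(8)[OF S e(1)]] in \<open>simp add: diff S e(1)\<close>)
    then show ?thesis
      unfolding sums_def LS[symmetric] by (rule LIM_zero_cancel)
  qed
  then have eq: "(\<lambda>z. L (e z)) = (\<lambda>z. \<Sum>n. a n * z ^ n)"
    by (simp add: sums_iff)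
  have der: "((\<lambda>z. L (e z)) has_field_derivative (\<Sum>n. diffs a n * z ^ n)) (at z)" for z
    unfolding eq by (rule termdiffs_strong_converges_everywhere) (use sums in \<open>simp add: sums_iff\<close>)
  then show "(\<lambda>z. L (e z)) holomorphic_on UNIV"
    by (auto simp: holomorphic_on_open)
  have "(\<Sum>n. diffs a n * 0 ^ n) = L w"
    by (simp add: powser_zero diffs_def a_def)
  with der[of 0] show "((\<lambda>z. L (e z)) has_field_derivative L w) (at 0)"
    by simp
qed

text \<open>The deviation \<open>v\<close> from linearity is additive and vanishes at integers, so
  its value at \<open>t\<close> is that at \<open>frac t\<close> and it is bounded. Boundedness
  along the multiples \<open>n * t\<close> forces it to be 0.\<close>

lemma additive_real_linear:
  fixes u :: "real \<Rightarrow> complex"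
  assumes add: "\<And>s t. u (s + t) = u s + u t" and bound: "\<And>t. cmod (u t) \<le> K * \<bar>t\<bar>"
  shows "u t = of_real t * u 1"
proof -
  define v where "v = (\<lambda>t. u t - of_real t * u 1)"
  have vadd: "v (s + t) = v s + v t" for s t
    by (simp add: v_def add algebra_simps)
  have v0: "v 0 = 0"
    using vadd[of 0 0] by simp
  have vn: "v (real n * s) = of_nat n * v s" for n s
    by (induction n) (simp_all add: v0 vadd algebra_simps)
  have vneg: "v (- s) = - v s" for s
    using vadd[of s "- s"] v0 by (simp add: eq_neg_iff_add_eq_0 add.commute)
  have v1: "v 1 = 0" by (simp add: v_def)
  have vint: "v (of_int k) = 0" for k :: int
    by (cases k rule: int_cases2) (use vn[of _ 1] v1 vneg in auto)
  have K: "K \<ge> 0" using bound[of 1] by (simp add: order_trans[OF norm_ge_zero])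
  have vle: "cmod (v t) \<le> 2 * K" for t
  proof -
    have "v t = v (frac t)"
      using vadd[of "of_int \<lfloor>t\<rfloor>" "frac t"] vint by (simp add: frac_def)
    also have "cmod \<dots> \<le> cmod (u (frac t)) + cmod (of_real (frac t) * u 1)"
      unfolding v_def by (rule norm_triangle_ineq4)
    also have "\<dots> \<le> K * \<bar>frac t\<bar> + \<bar>frac t\<bar> * K"
      using bound[of "frac t"] bound[of 1] mult_left_mono[of "cmod (u 1)" K "\<bar>frac t\<bar>"]
      by (simp add: norm_mult algebra_simps)
    also have "\<dots> \<le> 2 * K"
      using mult_left_mono[of "frac t" 1 K] K frac_lt_1[of t] frac_ge_0[of t] by (simp add: mult.commute)
    finally show ?thesis .
  qed
  have "v t = 0"
  proof (rule ccontr)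
    assume "v t \<noteq> 0"
    then obtain n :: nat where "2 * K < real n * cmod (v t)"
      using reals_Archimedean3[of "cmod (v t)"] by auto
    then show False
      using vle[of "real n * t"] by (simp add: vn norm_mult)
  qed
  then show ?thesis by (simp add: v_def)
qed

text \<open>The lower bound is all that remains of multiplicativity: it forces \<open>G x \<noteq> G y\<close> whenever
  \<open>x - y\<close> is invertible.\<close>

definition pinched :: "('k::topological_space \<Rightarrow>\<^sub>C complex) set \<Rightarrow> complex \<Rightarrow>
    (('k \<Rightarrow>\<^sub>C complex) \<Rightarrow> complex) set"
  where "pinched A \<alpha> = {G. (\<forall>x\<in>-A. G x = 0) \<and> G 0 = 0 \<and>
    (\<forall>x\<in>A. \<forall>y\<in>A. cmod (G x - G y) \<le> norm (x - y)) \<and>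
    (\<forall>x\<in>A. \<forall>y\<in>A. \<forall>m\<in>{m. \<forall>s. m \<le> cmod (apply_bcontfun (x - y) s)}. m \<le> cmod (G x - G y)) \<and>
    (\<forall>x\<in>A. \<forall>c. G (x + const_bcontfun c) = G x + \<alpha> * c)}"

lemma pinchedD:
  assumes "G \<in> pinched A \<alpha>"
  shows "x \<notin> A \<Longrightarrow> G x = 0" "G 0 = 0"
    "x \<in> A \<Longrightarrow> y \<in> A \<Longrightarrow> cmod (G x - G y) \<le> norm (x - y)"
    "x \<in> A \<Longrightarrow> y \<in> A \<Longrightarrow> (\<And>s. m \<le> cmod (apply_bcontfun (x - y) s)) \<Longrightarrow> m \<le> cmod (G x - G y)"
    "x \<in> A \<Longrightarrow> G (x + const_bcontfun c) = G x + \<alpha> * c"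
  using assms by (auto simp: pinched_def)

lemma rescale_pinched:
  assumes A: "uniform_algebra A" and G: "G \<in> pinched A \<alpha>" and a: "a \<in> A" and r: "r > 0"
  shows "rescale A a r G \<in> pinched A \<alpha>"
proof -
  note AD = uniform_algebraD[OF A]
  note GD = pinchedD[OF G]
  have mem: "a + r *\<^sub>R x \<in> A" if "x \<in> A" for x
    using that a by (auto simp: scaleR_eq_cscale AD)
  have diff: "cmod (rescale A a r G x - rescale A a r G y) = cmod (G (a + r *\<^sub>R x) - G (a + r *\<^sub>R y)) / r"
    if "x \<in> A" "y \<in> A" for x y
    using that r by (simp add: rescale_def divide_inverse flip: scaleR_diff_right)
  have "cmod (rescale A a r G x - rescale A a r G y) \<le> norm (x - y)" if "x \<in> A" "y \<in> A" for x y
  proof -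
    have "norm ((a + r *\<^sub>R x) - (a + r *\<^sub>R y)) = r * norm (x - y)"
      using r by (simp flip: scaleR_diff_right)
    then show ?thesis
      using GD(3)[OF mem mem, OF that] r by (simp add: diff that divide_le_eq mult.commute)
  qed
  moreover have "m \<le> cmod (rescale A a r G x - rescale A a r G y)"
    if "x \<in> A" "y \<in> A" "\<And>s. m \<le> cmod (apply_bcontfun (x - y) s)" for x y m
  proof -
    have "m * r \<le> cmod (apply_bcontfun ((a + r *\<^sub>R x) - (a + r *\<^sub>R y)) s)" for s
      using that(3)[of s] r by (simp add: mult.commute flip: scaleR_diff_right)
    from GD(4)[OF mem mem this, OF that(1,2)] show ?thesis
      using r by (simp add: diff that le_divide_eq)
  qed
  moreover have "rescale A a r G (x + const_bcontfun c) = rescale A a r G x + \<alpha> * c" if "x \<in> A" for x c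
  proof -
    have "a + r *\<^sub>R (x + const_bcontfun c) = (a + r *\<^sub>R x) + const_bcontfun (of_real r * c)"
      by (rule bcontfun_eqI) (simp add: complex_eq_iff algebra_simps)
    then show ?thesis
      using that GD(5)[OF mem[OF that], of "of_real r * c"] r AD(3)[OF that AD(6)]
      by (simp add: rescale_def scaleR_conv_of_real field_simps)
  qed
  ultimately show ?thesis
    by (auto simp: pinched_def rescale_def)
qed

lemma self_similar_pinched:
  assumes A: "uniform_algebra A" and ne: "pinched A \<alpha> \<noteq> {}"
  shows "self_similar A (pinched A \<alpha>)"
proof -
  note AD = uniform_algebraD[OF A]
  have "closed (pinched A \<alpha>)"
    unfolding pinched_def Collect_conj_eq Collect_ball_eq Collect_all_eq
    by (intro closed_Int closed_INT ballI closed_Collect_eq closed_Collect_le continuous_on_norm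
        continuous_on_diff continuous_on_add continuous_on_const continuous_on_product_coordinates)
  then have "compact ({f. \<forall>x. dist 0 (f x) \<le> norm x} \<inter> pinched A \<alpha>)"
    by (rule compact_Int_closed[OF compact_product_cball])
  moreover have "dist 0 (G x) \<le> norm x" if G: "G \<in> pinched A \<alpha>" for G x
  proof (cases "x \<in> A")
    case True
    then show ?thesis
      using pinchedD(3)[OF G True subspace_0[OF AD(7)]] pinchedD(2)[OF G] by simp
  qed (use pinchedD(1)[OF G] in simp)
  then have "{f. \<forall>x. dist 0 (f x) \<le> norm x} \<inter> pinched A \<alpha> = pinched A \<alpha>"
    by blast
  ultimately have "compact (pinched A \<alpha>)"
    by simp
  moreover have "continuous_on A G" if "G \<in> pinched A \<alpha>" for G
  proof -
    have "1-lipschitz_on A G"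
      using pinchedD(3)[OF that] by (intro lipschitz_onI) (auto simp: dist_norm)
    then show ?thesis by (rule lipschitz_on_continuous_on)
  qed
  ultimately show ?thesis
    using ne rescale_pinched[OF A] pinchedD(1,2) by (auto simp: self_similar_def)
qed

text \<open>Splitting \<open>D\<close> into a complex linear part \<open>L\<close> and the conjugate of a complex linear part \<open>M\<close>,
  the lower bound at \<open>c \<cdot> exp w\<close> for all \<open>c\<close> says \<open>\<bar>L (exp w)\<bar> \<noteq> \<bar>M (exp w)\<bar>\<close>, hence
  \<open>\<bar>M (exp w)\<bar> < \<bar>L (exp w)\<bar>\<close> by connectedness.  So \<open>z \<mapsto> M (exp (z w)) / L (exp (z w))\<close> is a bounded
  entire function that vanishes at \<open>0\<close>.\<close>

lemma pinched_additive_imp_complex_linear: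
  assumes A: "uniform_algebra A" and D: "D \<in> pinched A \<alpha>" and \<alpha>: "\<alpha> \<noteq> 0"
    and add: "\<And>x y. x \<in> A \<Longrightarrow> y \<in> A \<Longrightarrow> D (x + y) = D x + D y" and w: "w \<in> A"
  shows "D (cscale c w) = c * D w"
proof -
  note AD = uniform_algebraD[OF A]
  note DD = pinchedD[OF D]
  have bound: "cmod (D x) \<le> norm x" if "x \<in> A" for x
    using DD(3)[OF that subspace_0[OF AD(7)]] DD(2) by simp
  have cadd: "cscale (a + b) x = cscale a x + cscale b x" for a b and x :: "'a \<Rightarrow>\<^sub>C complex"
    by (rule bcontfun_eqI) (simp add: algebra_simps)
  have cmul: "cscale a (cscale b x) = cscale (a * b) x" for a b and x :: "'a \<Rightarrow>\<^sub>C complex"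
    by (rule bcontfun_eqI) simp
  have cadd': "cscale a (x + y) = cscale a x + cscale a y" for a and x y :: "'a \<Rightarrow>\<^sub>C complex"
    by (rule bcontfun_eqI) (simp add: algebra_simps)
  have c1: "cscale 1 x = x" for x :: "'a \<Rightarrow>\<^sub>C complex"
    by (rule bcontfun_eqI) simp
  have real: "D (cscale (of_real r) x) = of_real r * D x" if x: "x \<in> A" for r x
  proof -
    have "D (cscale (of_real r) x) = of_real r * D (cscale (of_real 1) x)"
    proof (rule additive_real_linear)
      show "D (cscale (of_real (s + t)) x) = D (cscale (of_real s) x) + D (cscale (of_real t) x)" for s t
        using x by (simp add: cadd add AD)
      show "cmod (D (cscale (of_real t) x)) \<le> norm x * \<bar>t\<bar>" for t
        using bound[OF AD(4)[OF x]] norm_cscale[of "of_real t" x] order_trans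
        by (fastforce simp: mult.commute)
    qed
    then show ?thesis by (simp add: c1)
  qed
  define L where "L = (\<lambda>x. (D x - \<i> * D (cscale \<i> x)) / 2)"
  define M where "M = (\<lambda>x. cnj ((D x + \<i> * D (cscale \<i> x)) / 2))"
  have complex: "D (cscale c x) = of_real (Re c) * D x + of_real (Im c) * D (cscale \<i> x)"
    if x: "x \<in> A" for c x
  proof -
    have "cscale c x = cscale (of_real (Re c)) x + cscale (of_real (Im c)) (cscale \<i> x)"
      by (subst complex_eq[of c]) (simp add: cadd cmul mult.commute)
    then show ?thesis
      using x by (simp add: add real AD)
  qed
  have DLM: "D x = L x + cnj (M x)" for x
    by (simp add: L_def M_def field_simps)
  have Lscale: "L (cscale c x) = c * L x" and Mscale: "M (cscale c x) = c * M x" if x: "x \<in> A" for c x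
  proof -
    have 1: "D (cscale \<i> (cscale c x)) = of_real (Re c) * D (cscale \<i> x) - of_real (Im c) * D x"
      using complex[OF x, of "\<i> * c"] by (simp add: cmul)
    have 2: "c = of_real (Re c) + \<i> * of_real (Im c)"
      by (rule complex_eq)
    show "L (cscale c x) = c * L x" "M (cscale c x) = c * M x"
      unfolding L_def M_def 1 complex[OF x, of c]
      by (subst 2; simp add: complex_eq_iff algebra_simps)+
  qed
  have Ladd: "L (x + y) = L x + L y" and Madd: "M (x + y) = M x + M y"
    if "x \<in> A" "y \<in> A" for x y
    using that by (simp_all add: L_def M_def cadd' add AD field_simps)
  have bi: "cmod (\<i> * D (cscale \<i> x)) \<le> norm x" if "x \<in> A" for x
    using bound[OF AD(4)[OF that, of \<i>]] norm_cscale[of \<i> x] by (simp add: norm_mult)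
  have Mnorm: "cmod (M x) = cmod (D x + \<i> * D (cscale \<i> x)) / 2" for x
    by (simp only: M_def complex_mod_cnj norm_divide norm_numeral)
  have Lbound: "cmod (L x) \<le> 1 * norm x" and Mbound: "cmod (M x) \<le> 1 * norm x" if "x \<in> A" for x
    using bound[OF that] bi[OF that] norm_triangle_ineq4[of "D x" "\<i> * D (cscale \<i> x)"]
      norm_triangle_ineq[of "D x" "\<i> * D (cscale \<i> x)"]
    by (simp_all add: L_def Mnorm norm_divide)
  have Mzero: "M x = 0" if x: "x \<in> A" for x
  proof -
    obtain e where e: "\<And>z. e z \<in> A" "\<And>z s. apply_bcontfun (e z) s = exp (z * apply_bcontfun x s)"
      "\<And>z. (\<lambda>N. \<Sum>n<N. cscale (z ^ n / fact n) (x ^ n)) \<longlonglongrightarrow> e z"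
      by (rule uniform_algebra_exp[OF A x]) blast
    note Lexp = functional_exp[OF A x e(1,3) Ladd Lscale Lbound]
    note Mexp = functional_exp[OF A x e(1,3) Madd Mscale Mbound]
    define l where "l = (\<lambda>z. L (e z))"
    define m where "m = (\<lambda>z. M (e z))"
    have lhol: "l holomorphic_on UNIV" and mhol: "m holomorphic_on UNIV"
      and mder: "(m has_field_derivative M x) (at 0)"
      using Lexp Mexp unfolding l_def m_def by blast+
    have e0: "e 0 = const_bcontfun 1"
      by (rule bcontfun_eqI) (simp add: e)
    have Dc: "D (const_bcontfun c) = \<alpha> * c" for c
      using DD(5)[OF subspace_0[OF AD(7)], of c] DD(2) by simp
    have ci: "cscale \<i> (const_bcontfun 1) = (const_bcontfun \<i> :: 'a \<Rightarrow>\<^sub>C complex)"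
      by (rule bcontfun_eqI) simp
    \<comment> \<open>The prescribed behaviour on constants enters here: \<open>D\<close> is complex
      linear on them, so \<open>M\<close> vanishes at \<open>e 0\<close>. This starts the
      connectedness argument and fixes the constant in Liouville's theorem.\<close>
    have l0: "l 0 = \<alpha>" and m0: "m 0 = 0"
      by (simp_all add: l_def m_def L_def M_def e0 ci Dc complex_eq_iff)
    \<comment> \<open>Equal moduli would allow a unimodular \<open>c\<close> with
      \<open>D (cscale c (e z)) = 0\<close>, although \<open>cscale c (e z)\<close> is bounded away
      from 0 by \<open>exp (- cmod z * norm x)\<close>.\<close>
    have ne: "cmod (l z) \<noteq> cmod (m z)" for z
    proof
      assume eq: "cmod (l z) = cmod (m z)"
      have "\<exists>c. cmod c = 1 \<and> c * l z + cnj (c * m z) = 0"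
      proof (cases "m z = 0")
        case True
        then show ?thesis using eq by (intro exI[of _ 1]) simp
      next
        case False
        \<comment> \<open>For unimodular \<open>c\<close>, multiplying the desired equation by
          \<open>c\<close> turns it into \<open>c\<^sup>2 * l z = - cnj (m z)\<close>.\<close>
        define c where "c = csqrt (- (cnj (m z) / l z))"
        have lz: "l z \<noteq> 0" using False eq by auto
        have cc: "c * c * l z = - cnj (m z)"
          using power2_csqrt[of "- (cnj (m z) / l z)"] lz by (simp add: c_def power2_eq_square)
        then have "cmod c * cmod c * cmod (l z) = cmod (l z)"
          using eq by (metis complex_mod_cnj norm_minus_cancel norm_mult)
        then have "(cmod c)\<^sup>2 = 1"
          using lz by (simp add: power2_eq_square)
        then have c: "cmod c = 1"
          by (simp add: power2_eq_1_iff) (use norm_ge_zero[of c] in linarith)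
        have "c * (c * l z + cnj (c * m z)) = c * c * l z + (c * cnj c) * cnj (m z)"
          by (simp add: algebra_simps)
        also have "\<dots> = 0"
          using cc c by (simp add: complex_norm_square[symmetric])
        finally show ?thesis
          using c by (metis mult_eq_0_iff norm_zero zero_neq_one)
      qed
      then obtain c where c: "cmod c = 1" "c * l z + cnj (c * m z) = 0" by blast
      have "D (cscale c (e z)) = 0"
        using c(2) by (simp add: DLM Lscale Mscale e l_def m_def)
      moreover have "exp (- cmod z * norm x) \<le> cmod (D (cscale c (e z)) - D 0)"
      proof (rule DD(4)[OF AD(4)[OF e(1)] subspace_0[OF AD(7)]])
        fix s
        have "\<bar>Re (z * apply_bcontfun x s)\<bar> \<le> cmod z * norm x"
          by (rule order_trans[OF abs_Re_le_cmod])
            (simp add: norm_mult mult_left_mono norm_bounded)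
        then show "exp (- cmod z * norm x) \<le> cmod (apply_bcontfun (cscale c (e z) - 0) s)"
          using c(1) by (simp add: e norm_mult)
      qed
      ultimately show False
        using DD(2) by (simp add: not_le[symmetric])
    qed
    have less: "cmod (m z) < cmod (l z)" for z
    proof (rule ccontr)
      assume nless: "\<not> ?thesis"
      have cont: "continuous_on UNIV (\<lambda>z. cmod (l z) - cmod (m z))"
        by (intro continuous_intros holomorphic_on_imp_continuous_on lhol mhol)
      have "connected ((\<lambda>z. cmod (l z) - cmod (m z)) ` UNIV)"
        by (rule connected_continuous_image[OF cont connected_UNIV])
      moreover have "cmod (l z) - cmod (m z) \<le> 0" "0 \<le> cmod (l 0) - cmod (m 0)"
        using nless by (simp_all add: m0)
      ultimately have "0 \<in> range (\<lambda>z. cmod (l z) - cmod (m z))"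
        by (meson connectedD_interval rangeI)
      then show False using ne by auto
    qed
    have lne: "l z \<noteq> 0" for z
      using less[of z] by auto
    have "(\<lambda>z. m z / l z) holomorphic_on UNIV"
      using lne by (intro holomorphic_on_divide lhol mhol) auto
    moreover have "bounded (range (\<lambda>z. m z / l z))"
      unfolding bounded_iff
      by (intro exI[of _ 1]) (use less lne in \<open>auto simp: norm_divide less_imp_le\<close>)
    ultimately have "(\<lambda>z. m z / l z) constant_on UNIV"
      by (rule Liouville_theorem)
    then have "m z / l z = m 0 / l 0" for z
      unfolding constant_on_def by auto
    then have "m = (\<lambda>_. 0)"
      using m0 lne by auto
    \<comment> \<open>The exponentials recover \<open>M x\<close> itself as the derivative of
      \<open>m\<close> at 0.\<close>
    with mder show ?thesis
      by (metis DERIV_const DERIV_unique)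
  qed
  show ?thesis
    using w by (simp add: DLM Mzero Lscale AD)
qed

section \<open>Holomorphy along complex lines\<close>

text \<open>Left-endpoint Riemann sums over \<open>2 ^ n\<close> equal pieces, obtained by repeated
  bisection. They use finitely many values of \<open>f\<close> and hence are continuous in
  \<open>f\<close> for pointwise convergence.\<close>

fun midpoint_sum :: "(complex \<Rightarrow> complex) \<Rightarrow> nat \<Rightarrow> complex \<Rightarrow> complex \<Rightarrow> complex" where
  "midpoint_sum f 0 p q = f p * (q - p)"
| "midpoint_sum f (Suc n) p q =
    midpoint_sum f n p (midpoint p q) + midpoint_sum f n (midpoint p q) q"

text \<open>The bound is quadratic in the length, so each half contributes a quarter of it and every
  bisection halves the total.\<close>

lemma midpoint_sum_error:
  assumes lip: "\<And>x y. cmod (f x - f y) \<le> K * cmod (x - y)" and cont: "continuous_on UNIV f"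
  shows "cmod (contour_integral (linepath p q) f - midpoint_sum f n p q) \<le> K * (cmod (q - p))\<^sup>2 / 2 ^ n"
proof (induction n arbitrary: p q)
  case 0
  have K: "K \<ge> 0"
    using lip[of 1 0] by (simp add: order_trans[OF norm_ge_zero])
  have int: "f contour_integrable_on linepath p q"
    by (rule contour_integrable_continuous_linepath[OF continuous_on_subset[OF cont subset_UNIV]])
  have "contour_integral (linepath p q) f - f p * (q - p) =
      contour_integral (linepath p q) (\<lambda>x. f x - f p)"
    using int by (simp add: contour_integral_diff)
  also have "cmod \<dots> \<le> (K * cmod (q - p)) * cmod (q - p)"
  proof (rule contour_integral_bound_linepath)
    show "(\<lambda>x. f x - f p) contour_integrable_on linepath p q"
      using int by (intro contour_integrable_diff) auto
    show "cmod (f x - f p) \<le> K * cmod (q - p)" if "x \<in> closed_segment p q" for x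
      using lip[of x p] K mult_left_mono[OF segment_bound(1)[OF that] K] by linarith
  qed (use K in simp)
  finally show ?case
    by (simp add: power2_eq_square mult.assoc)
next
  case (Suc n)
  let ?m = "midpoint p q"
  have split: "contour_integral (linepath p q) f =
      contour_integral (linepath p ?m) f + contour_integral (linepath ?m q) f"
    by (intro contour_integral_midpoint continuous_on_subset[OF cont subset_UNIV])
  have half: "cmod (?m - p) = cmod (q - p) / 2" "cmod (q - ?m) = cmod (q - p) / 2"
    using dist_midpoint[of p q] by (simp_all add: dist_norm norm_minus_commute)
  have "cmod (contour_integral (linepath p q) f - midpoint_sum f (Suc n) p q) \<le>
      cmod (contour_integral (linepath p ?m) f - midpoint_sum f n p ?m) +
      cmod (contour_integral (linepath ?m q) f - midpoint_sum f n ?m q)"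
    unfolding split midpoint_sum.simps by (rule norm_diff_triangle_ineq)
  also have "\<dots> \<le> K * (cmod (?m - p))\<^sup>2 / 2 ^ n + K * (cmod (q - ?m))\<^sup>2 / 2 ^ n"
    by (intro add_mono Suc.IH)
  also have "\<dots> = K * (cmod (q - p))\<^sup>2 / 2 ^ Suc n"
    unfolding half by (simp add: power_divide field_simps)
  finally show ?case .
qed

text \<open>The common Lipschitz constant makes the Riemann sums converge uniformly over
  \<open>C\<close>, and each of them is continuous.\<close>

lemma continuous_on_contour_integral_pointwise:
  fixes C :: "('a \<Rightarrow> complex) set" and \<gamma> :: "complex \<Rightarrow> 'a"
  assumes lip: "\<And>G x y. G \<in> C \<Longrightarrow> cmod (G (\<gamma> x) - G (\<gamma> y)) \<le> K * cmod (x - y)"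
  shows "continuous_on C (\<lambda>G. contour_integral (linepath p q) (\<lambda>z. G (\<gamma> z)))"
proof (rule uniform_limit_theorem)
  have cont: "continuous_on UNIV (\<lambda>z. G (\<gamma> z))" if "G \<in> C" for G
  proof -
    have "K \<ge> 0"
      using lip[OF that, of 1 0] by (simp add: order_trans[OF norm_ge_zero])
    then have "K-lipschitz_on UNIV (\<lambda>z. G (\<gamma> z))"
      using lip[OF that] by (intro lipschitz_onI) (auto simp: dist_norm)
    then show ?thesis by (rule lipschitz_on_continuous_on)
  qed
  have "continuous_on C (\<lambda>G. midpoint_sum (\<lambda>z. G (\<gamma> z)) n p q)" for n p q
    by (induction n arbitrary: p q)
      (auto intro!: continuous_on_add continuous_on_mult_right
        continuous_on_subset[OF continuous_on_product_coordinates])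
  then show "\<forall>\<^sub>F n in sequentially. continuous_on C (\<lambda>G. midpoint_sum (\<lambda>z. G (\<gamma> z)) n p q)"
    by simp
  show "uniform_limit C (\<lambda>n G. midpoint_sum (\<lambda>z. G (\<gamma> z)) n p q)
      (\<lambda>G. contour_integral (linepath p q) (\<lambda>z. G (\<gamma> z))) sequentially"
  proof (rule uniform_limitI)
    fix e :: real assume "e > 0"
    have "(\<lambda>n. (1/2) ^ n :: real) \<longlonglongrightarrow> 0"
      by (rule LIMSEQ_power_zero) simp
    then have "(\<lambda>n. K * (cmod (q - p))\<^sup>2 * (1/2) ^ n) \<longlonglongrightarrow> 0"
      by (rule tendsto_mult_right_zero)
    then have "\<forall>\<^sub>F n in sequentially. K * (cmod (q - p))\<^sup>2 / 2 ^ n < e"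
      using \<open>e > 0\<close> order_tendstoD(2) by (fastforce simp: power_divide)
    then show "\<forall>\<^sub>F n in sequentially. \<forall>G\<in>C. dist (midpoint_sum (\<lambda>z. G (\<gamma> z)) n p q)
        (contour_integral (linepath p q) (\<lambda>z. G (\<gamma> z))) < e"
    proof (eventually_elim, intro ballI)
      fix n G assume "K * (cmod (q - p))\<^sup>2 / 2 ^ n < e" and G: "G \<in> C"
      then show "dist (midpoint_sum (\<lambda>z. G (\<gamma> z)) n p q)
          (contour_integral (linepath p q) (\<lambda>z. G (\<gamma> z))) < e"
        using midpoint_sum_error[OF lip[OF G] cont[OF G], of p q n]
        by (simp add: dist_norm norm_minus_commute)
    qed
  qed
qed auto

text \<open>Substituting \<open>w + r * z\<close> gives one factor \<open>1 / r\<close>, and the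
  difference quotient gives the other.\<close>

lemma contour_integral_linepath_affine:
  assumes cont: "continuous_on UNIV f" and r: "r \<noteq> 0"
  shows "contour_integral (linepath a b) (\<lambda>z. (f (w + r * z) - k) / r) =
    contour_integral (linepath (w + r * a) (w + r * b)) f / r\<^sup>2 - k * (b - a) / r"
proof (rule contour_integral_unique)
  let ?I = "contour_integral (linepath (w + r * a) (w + r * b)) f"
  have "(f has_contour_integral ?I) (linepath (w + r * a) (w + r * b))"
    by (intro has_contour_integral_integral contour_integrable_continuous_linepath
        continuous_on_subset[OF cont subset_UNIV])
  then have "((\<lambda>t. f (linepath (w + r * a) (w + r * b) t) * (r * (b - a))) has_integral ?I) {0..1}"
    by (simp add: has_contour_integral_linepath right_diff_distrib)
  moreover have "linepath (w + r * a) (w + r * b) t = w + r * linepath a b t" for t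
    by (simp add: linepath_def algebra_simps)
  ultimately have "((\<lambda>t. f (w + r * linepath a b t) * (r * (b - a))) has_integral ?I) {0..1}"
    by simp
  then have "((\<lambda>t. f (w + r * linepath a b t) * (r * (b - a)) / r\<^sup>2) has_integral ?I / r\<^sup>2) {0..1}"
    by (rule has_integral_divide)
  moreover have "f (w + r * linepath a b t) * (r * (b - a)) / r\<^sup>2 = f (w + r * linepath a b t) / r * (b - a)" for t
    using r by (simp add: power2_eq_square)
  ultimately have "((\<lambda>z. f (w + r * z) / r) has_contour_integral ?I / r\<^sup>2) (linepath a b)"
    by (simp add: has_contour_integral_linepath)
  from has_contour_integral_diff[OF this has_contour_integral_const_linepath[of "k / r"]]
  show "((\<lambda>z. (f (w + r * z) - k) / r) has_contour_integral ?I / r\<^sup>2 - k * (b - a) / r) (linepath a b)"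
    by (simp add: diff_divide_distrib)
qed

section \<open>Subdividing parallelograms and triangles\<close>

definition parallelogram_integral :: "complex \<Rightarrow> complex \<Rightarrow> (complex \<Rightarrow> complex) \<Rightarrow> complex"
  where "parallelogram_integral a b f =
    contour_integral (linepath 0 a) f + contour_integral (linepath a (a + b)) f +
    contour_integral (linepath (a + b) b) f + contour_integral (linepath b 0) f"

definition triangle_integral :: "complex \<Rightarrow> complex \<Rightarrow> (complex \<Rightarrow> complex) \<Rightarrow> complex"
  where "triangle_integral a b f =
    contour_integral (linepath 0 a) f + contour_integral (linepath a b) f +
    contour_integral (linepath b 0) f"

text \<open>The edges of a closed polygon sum to 0, so the terms containing \<open>k\<close> cancel.
  Triangles behave likewise.\<close>

lemma parallelogram_integral_affine:
  assumes "continuous_on UNIV f" "r \<noteq> 0"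
  shows "r\<^sup>2 * parallelogram_integral a b (\<lambda>z. (f (w + r * z) - k) / r) =
    contour_integral (linepath w (w + r * a)) f + contour_integral (linepath (w + r * a) (w + r * (a + b))) f +
    contour_integral (linepath (w + r * (a + b)) (w + r * b)) f + contour_integral (linepath (w + r * b) w) f"
  unfolding parallelogram_integral_def contour_integral_linepath_affine[OF assms]
  using assms(2) by (simp add: field_simps)

lemma triangle_integral_affine:
  assumes "continuous_on UNIV f" "r \<noteq> 0"
  shows "r\<^sup>2 * triangle_integral a b (\<lambda>z. (f (w + r * z) - k) / r) =
    contour_integral (linepath w (w + r * a)) f + contour_integral (linepath (w + r * a) (w + r * b)) f +
    contour_integral (linepath (w + r * b) w) f"
  unfolding triangle_integral_def contour_integral_linepath_affine[OF assms]
  using assms(2) by (simp add: field_simps)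

text \<open>Four half-size copies with corners \<open>w\<close> tile the parallelogram, and each
  inner edge is traversed twice in opposite directions.\<close>

lemma parallelogram_integral_subdivide:
  assumes f: "continuous_on UNIV f"
  shows "parallelogram_integral a b f =
    (\<Sum>w\<leftarrow>[0, a/2, b/2, (a+b)/2]. (1/2)\<^sup>2 * parallelogram_integral a b (\<lambda>z. (f (w + 1/2 * z) - k w) / (1/2)))"
proof -
  define I where "I p q = contour_integral (linepath p q) f" for p q
  have split: "I p q = I p m + I m q" if "m = (p + q) / 2" for p q m
    using contour_integral_midpoint[OF continuous_on_subset[OF f subset_UNIV], of p q]
    by (simp add: I_def that midpoint_def scaleR_conv_of_real)
  have rev: "I p q = - I q p" for p q
    unfolding I_def
    by (rule contour_integral_reverse_linepath[OF continuous_on_subset[OF f subset_UNIV]])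
  have half: "(1/2 :: complex) \<noteq> 0" by simp
  note aff = parallelogram_integral_affine[OF f half, folded I_def]
  have outer: "I 0 a = I 0 (a/2) + I (a/2) a" "I a (a+b) = I a (a + b/2) + I (a + b/2) (a+b)"
    "I (a+b) b = I (a+b) (a/2 + b) + I (a/2 + b) b" "I b 0 = I b (b/2) + I (b/2) 0"
    by (rule split; simp add: field_simps)+
  have pts: "(a + b)/2 = a/2 + b/2" "a/2 + 1/2 * (a + b) = a + b/2" "b/2 + 1/2 * (a + b) = a/2 + b"
    "a/2 + b/2 + 1/2 * (a + b) = a + b" "a/2 + 1/2 * a = a" "b/2 + 1/2 * b = b"
    "b/2 + 1/2 * a = a/2 + b/2" "a/2 + b/2 + 1/2 * a = a + b/2" "a/2 + b/2 + 1/2 * b = a/2 + b"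
    "a/2 + 1/2 * b = a/2 + b/2" "0 + 1/2 * (a + b) = a/2 + b/2" "0 + 1/2 * a = a/2" "0 + 1/2 * b = b/2"
    by (simp_all add: field_simps)
  have P: "parallelogram_integral a b f = I 0 a + I a (a + b) + I (a + b) b + I b 0"
    by (simp add: parallelogram_integral_def I_def)
  show ?thesis
    unfolding P list.map sum_list_simps aff pts outer
    using rev[of "a/2" "a/2 + b/2"] rev[of "b/2" "a/2 + b/2"]
      rev[of "a + b/2" "a/2 + b/2"] rev[of "a/2 + b" "a/2 + b/2"]
    by (simp add: algebra_simps)
qed

text \<open>Removing the parallelogram with corners 0, \<open>a/2\<close>, \<open>(a+b)/2\<close>
  and \<open>b/2\<close> leaves two half-size triangles in the original position. Both are reached
  by rescaling with the positive factor 1/2, and two summands weighted by 1/4 make the integrals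
  decay.\<close>

lemma triangle_integral_subdivide:
  assumes f: "continuous_on UNIV f"
    and parallelogram: "parallelogram_integral (a/2) (b/2) f = 0"
  shows "triangle_integral a b f =
    (\<Sum>w\<leftarrow>[a/2, b/2]. (1/2)\<^sup>2 * triangle_integral a b (\<lambda>z. (f (w + 1/2 * z) - k w) / (1/2)))"
proof -
  define I where "I p q = contour_integral (linepath p q) f" for p q
  have split: "I p q = I p m + I m q" if "m = (p + q) / 2" for p q m
    using contour_integral_midpoint[OF continuous_on_subset[OF f subset_UNIV], of p q]
    by (simp add: I_def that midpoint_def scaleR_conv_of_real)
  have rev: "I p q = - I q p" for p q
    unfolding I_def
    by (rule contour_integral_reverse_linepath[OF continuous_on_subset[OF f subset_UNIV]])
  have half: "(1/2 :: complex) \<noteq> 0" by simp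
  note aff = triangle_integral_affine[OF f half, folded I_def]
  have outer: "I 0 a = I 0 (a/2) + I (a/2) a" "I a b = I a (a/2 + b/2) + I (a/2 + b/2) b"
    "I b 0 = I b (b/2) + I (b/2) 0"
    by (rule split; simp add: field_simps)+
  have pts: "a/2 + 1/2 * a = a" "b/2 + 1/2 * b = b" "b/2 + 1/2 * a = a/2 + b/2"
    "a/2 + 1/2 * b = a/2 + b/2"
    by (simp_all add: field_simps)
  have T: "triangle_integral a b f = I 0 a + I a b + I b 0"
    by (simp add: triangle_integral_def I_def)
  have P: "I 0 (a/2) + I (a/2) (a/2 + b/2) + I (a/2 + b/2) (b/2) + I (b/2) 0 = 0"
    using parallelogram by (simp add: parallelogram_integral_def I_def)
  show ?thesis
    unfolding T list.map sum_list_simps aff pts outer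
    using rev[of "a/2" "a/2 + b/2"] rev[of "b/2" "a/2 + b/2"] P
    by (simp add: algebra_simps)
qed

section \<open>Pinched functionals on complex lines\<close>

lemma rescale_complex_line:
  assumes A: "uniform_algebra A" and g: "g \<in> A"
  shows "rescale A (cscale w g) r G (cscale z g) =
    (G (cscale (w + of_real r * z) g) - G (cscale w g)) / of_real r"
proof -
  have "cscale w g + r *\<^sub>R cscale z g = cscale (w + of_real r * z) g"
    by (rule bcontfun_eqI) (simp add: complex_eq_iff algebra_simps)
  then show ?thesis
    using uniform_algebraD(4)[OF A g]
    by (simp add: rescale_def scaleR_conv_of_real divide_inverse mult.commute)
qed

lemma pinched_lipschitz_complex_line:
  assumes A: "uniform_algebra A" and g: "g \<in> A" and G: "G \<in> pinched A \<alpha>"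
  shows "cmod (G (cscale x g) - G (cscale y g)) \<le> norm g * cmod (x - y)"
proof -
  have "cscale x g - cscale y g = cscale (x - y) g"
    by (rule bcontfun_eqI) (simp add: algebra_simps)
  then show ?thesis
    using pinchedD(3)[OF G uniform_algebraD(4)[OF A g] uniform_algebraD(4)[OF A g], of x y]
      norm_cscale[of "x - y" g] by (simp add: mult.commute)
qed

lemma pinched_continuous_complex_line:
  assumes "uniform_algebra A" "g \<in> A" "G \<in> pinched A \<alpha>"
  shows "continuous_on S (\<lambda>z. G (cscale z g))"
proof -
  have "(norm g)-lipschitz_on S (\<lambda>z. G (cscale z g))"
    using pinched_lipschitz_complex_line[OF assms] by (intro lipschitz_onI) (auto simp: dist_norm)
  then show ?thesis by (rule lipschitz_on_continuous_on)
qed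

text \<open>Otherwise a phase-rotated parallelogram integral has a positive supremum, and
  extremality passes to an additive limit, which is complex linear and has zero integral.\<close>

lemma pinched_parallelogram_integral_eq_0:
  assumes A: "uniform_algebra A" and g: "g \<in> A" and \<alpha>: "\<alpha> \<noteq> 0" and G: "G \<in> pinched A \<alpha>"
  shows "parallelogram_integral a b (\<lambda>z. G (cscale z g)) = 0"
proof (rule ccontr)
  assume ne: "\<not> ?thesis"
  note AD = uniform_algebraD[OF A]
  define P where "P = (\<lambda>G. parallelogram_integral a b (\<lambda>z. G (cscale z g)))"
  define J where "J = (\<lambda>H. Re (cnj (P G) * P H))"
  \<comment> \<open>The base points correspond to the corners of the four half-size
    parallelograms.\<close>
  define off where "off = (\<lambda>i. cscale ([0, a/2, b/2, (a+b)/2] ! i) g)"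
  have C: "self_similar A (pinched A \<alpha>)"
    using self_similar_pinched[OF A] G by blast
  have contJ: "continuous_on (pinched A \<alpha>) J"
    unfolding J_def P_def parallelogram_integral_def
    by (intro continuous_on_Re continuous_on_mult_left continuous_on_add
        continuous_on_contour_integral_pointwise[OF pinched_lipschitz_complex_line[OF A g]])
  have offA: "off i \<in> A" for i
    by (simp add: off_def AD g)
  have off0: "off 0 = 0"
    by (rule bcontfun_eqI) (simp add: off_def)
  have avg: "real 4 * J H = (\<Sum>i<4. J (rescale A (off i) (1/2) H))" if H: "H \<in> pinched A \<alpha>" for H
  proof -
    have "4 * P H = (\<Sum>i<4. P (rescale A (off i) (1/2) H))"
      unfolding P_def off_def rescale_complex_line[OF A g]
      using parallelogram_integral_subdivide[OF pinched_continuous_complex_line[OF A g H],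
          of a b "\<lambda>w. H (cscale w g)"]
      by (simp add: eval_nat_numeral power2_eq_square algebra_simps)
    then have "cnj (P G) * (4 * P H) = (\<Sum>i<4. cnj (P G) * P (rescale A (off i) (1/2) H))"
      by (simp add: sum_distrib_left)
    then have "Re (cnj (P G) * (4 * P H)) = (\<Sum>i<4. J (rescale A (off i) (1/2) H))"
      by (simp add: J_def)
    then show ?thesis
      by (simp add: J_def algebra_simps)
  qed
  obtain c where c: "J G \<le> c"
    "self_similar A {H \<in> pinched A \<alpha>. \<forall>a\<in>A. \<forall>n. J (rescale A a ((1/2) ^ n) H) = c}"
    by (rule self_similar_extremal[OF AD(7) C contJ _ offA off0 avg G]) auto
  have "J G = (cmod (P G))\<^sup>2"
    unfolding J_def by (metis Re_complex_of_real complex_norm_square mult.commute)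
  then have "c > 0"
    using ne c(1) by (auto simp: P_def intro: less_le_trans[rotated])
  obtain D where D: "D \<in> pinched A \<alpha>" "\<And>a n. a \<in> A \<Longrightarrow> J (rescale A a ((1/2) ^ n) D) = c"
    "\<And>x y. x \<in> A \<Longrightarrow> y \<in> A \<Longrightarrow> D (x + y) = D x + D y"
    using self_similar_additive[OF AD(7) c(2)] by blast
  have "rescale A 0 1 D = D"
    using self_similarD(9)[OF C D(1)] .
  then have "J D = c"
    using D(2)[OF subspace_0[OF AD(7)], of 0] by simp
  moreover have "P D = 0"
    using pinched_additive_imp_complex_linear[OF A D(1) \<alpha> D(3) g]
    by (simp add: P_def parallelogram_integral_def contour_integral_rmul algebra_simps
        power2_eq_square diff_divide_distrib add_divide_distrib)
  ultimately show False
    using \<open>c > 0\<close> by (simp add: J_def)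
qed

text \<open>The bound \<open>M\<close> is uniform over the class. As parallelogram integrals vanish,
  four times \<open>T H\<close> is a sum of two values of \<open>T\<close> at blow-ups of
  \<open>H\<close>, which are again in the class; so the uniform bound can be halved
  indefinitely.\<close>

lemma pinched_triangle_integral_eq_0:
  assumes A: "uniform_algebra A" and g: "g \<in> A" and \<alpha>: "\<alpha> \<noteq> 0" and G: "G \<in> pinched A \<alpha>"
  shows "triangle_integral a b (\<lambda>z. G (cscale z g)) = 0"
proof -
  note AD = uniform_algebraD[OF A]
  define T where "T = (\<lambda>G. triangle_integral a b (\<lambda>z. G (cscale z g)))"
  \<comment> \<open>On the triangle \<open>cmod z \<le> cmod a + cmod b\<close>, so the Lipschitz
    constant \<open>norm g\<close> and \<open>H 0 = 0\<close> bound the integrand by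
    \<open>B\<close>; \<open>M\<close> is \<open>B\<close> times the perimeter.\<close>
  define B where "B = norm g * (cmod a + cmod b)"
  define M where "M = B * cmod a + B * cmod (b - a) + B * cmod b"
  have T0: "cmod (T H) \<le> M" if H: "H \<in> pinched A \<alpha>" for H
  proof -
    have seg: "cmod (contour_integral (linepath p q) (\<lambda>z. H (cscale z g))) \<le> B * cmod (q - p)"
      if pq: "p \<in> {0, a, b}" "q \<in> {0, a, b}" for p q
    proof (rule contour_integral_bound_linepath)
      show "(\<lambda>z. H (cscale z g)) contour_integrable_on linepath p q"
        by (intro contour_integrable_continuous_linepath pinched_continuous_complex_line[OF A g H])
      show "0 \<le> B" by (simp add: B_def)
      fix z assume "z \<in> closed_segment p q"
      moreover have "closed_segment p q \<subseteq> cball 0 (cmod a + cmod b)"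
        by (rule closed_segment_subset) (use pq in auto)
      ultimately have "cmod z \<le> cmod a + cmod b" by auto
      then have "norm g * cmod z \<le> B"
        unfolding B_def by (intro mult_left_mono) auto
      moreover have "cscale 0 g = 0"
        by (rule bcontfun_eqI) simp
      ultimately show "cmod (H (cscale z g)) \<le> B"
        using pinched_lipschitz_complex_line[OF A g H, of z 0] pinchedD(2)[OF H] by simp
    qed
    have "cmod (T H) \<le> B * cmod (a - 0) + B * cmod (b - a) + B * cmod (0 - b)"
      unfolding T_def triangle_integral_def
      by (intro norm_triangle_mono seg) auto
    then show ?thesis by (simp add: M_def)
  qed
  have Tn: "cmod (T H) \<le> M / 2 ^ n" if "H \<in> pinched A \<alpha>" for H n
    using that
  proof (induction n arbitrary: H)
    case 0
    then show ?case using T0 by simp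
  next
    case (Suc n)
    let ?H = "\<lambda>w. rescale A (cscale w g) (1/2) H"
    have mem: "?H w \<in> pinched A \<alpha>" for w
      using rescale_pinched[OF A Suc.prems AD(4)[OF g]] by simp
    have "4 * T H = T (?H (a/2)) + T (?H (b/2))"
      unfolding T_def rescale_complex_line[OF A g]
      using triangle_integral_subdivide[OF pinched_continuous_complex_line[OF A g Suc.prems]
          pinched_parallelogram_integral_eq_0[OF A g \<alpha> Suc.prems], of a b "\<lambda>w. H (cscale w g)"]
      by (simp add: power2_eq_square algebra_simps)
    then have "4 * cmod (T H) \<le> cmod (T (?H (a/2))) + cmod (T (?H (b/2)))"
      using norm_triangle_ineq[of "T (?H (a/2))" "T (?H (b/2))"] by (metis norm_mult norm_numeral)
    also have "\<dots> \<le> M / 2 ^ n + M / 2 ^ n"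
      by (intro add_mono Suc.IH mem)
    finally show ?case
      by simp
  qed
  have "(\<lambda>n. (1/2) ^ n :: real) \<longlonglongrightarrow> 0"
    by (rule LIMSEQ_power_zero) simp
  then have "(\<lambda>n. M * (1/2) ^ n) \<longlonglongrightarrow> 0"
    by (rule tendsto_mult_right_zero)
  then have "cmod (T G) \<le> 0"
    by (rule LIMSEQ_le_const) (use Tn[OF G] in \<open>auto simp: power_divide\<close>)
  then show ?thesis
    by (simp add: T_def)
qed

text \<open>Morera's theorem. Translation by \<open>cscale p g\<close> moves an arbitrary triangle
  to one with a vertex at 0.\<close>

lemma pinched_holomorphic_complex_line:
  assumes A: "uniform_algebra A" and g: "g \<in> A" and \<alpha>: "\<alpha> \<noteq> 0" and G: "G \<in> pinched A \<alpha>"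
  shows "(\<lambda>z. G (cscale z g)) holomorphic_on UNIV"
proof -
  note AD = uniform_algebraD[OF A]
  have "contour_integral (linepath p q) (\<lambda>z. G (cscale z g)) +
      contour_integral (linepath q r) (\<lambda>z. G (cscale z g)) +
      contour_integral (linepath r p) (\<lambda>z. G (cscale z g)) = 0" for p q r
  proof -
    have "rescale A (cscale p g) 1 G \<in> pinched A \<alpha>"
      by (rule rescale_pinched[OF A G]) (simp_all add: AD g)
    from pinched_triangle_integral_eq_0[OF A g \<alpha> this, of "q - p" "r - p"]
    show ?thesis
      using triangle_integral_affine[OF pinched_continuous_complex_line[OF A g G],
          of 1 "q - p" "r - p" p "G (cscale p g)"]
      by (simp add: rescale_complex_line[OF A g])
  qed
  then have "(\<lambda>z. G (cscale z g)) analytic_on UNIV"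
    by (intro Morera_triangle pinched_continuous_complex_line[OF A g G]) auto
  then show ?thesis
    by (rule analytic_imp_holomorphic)
qed

text \<open>The defect \<open>h z\<close> of additivity for \<open>x\<close> and
  \<open>cscale z g\<close> is entire. Moving by \<open>x\<close> changes \<open>G\<close> by at
  most \<open>norm x\<close>, so \<open>h\<close> is bounded and therefore constant, and it vanishes
  at 0.\<close>

lemma pinched_additive:
  assumes A: "uniform_algebra A" and \<alpha>: "\<alpha> \<noteq> 0" and G: "G \<in> pinched A \<alpha>"
    and x: "x \<in> A" and g: "g \<in> A"
  shows "G (x + g) = G x + G g"
proof -
  note AD = uniform_algebraD[OF A]
  note GD = pinchedD[OF G]
  have H: "rescale A x 1 G \<in> pinched A \<alpha>"
    by (rule rescale_pinched[OF A G x]) simp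
  have Hline: "rescale A x 1 G (cscale z g) = G (x + cscale z g) - G x" for z
    by (simp add: rescale_def AD g)
  define h where "h = (\<lambda>z. rescale A x 1 G (cscale z g) - G (cscale z g))"
  have "h holomorphic_on UNIV"
    unfolding h_def by (intro holomorphic_on_diff pinched_holomorphic_complex_line[OF A g \<alpha>] H G)
  moreover have "bounded (range h)"
  proof -
    have "cmod (h z) \<le> 2 * norm x" for z
    proof -
      have "cmod (G (x + cscale z g) - G (cscale z g)) \<le> norm x"
        using GD(3)[of "x + cscale z g" "cscale z g"] AD g x by simp
      moreover have "cmod (G x) \<le> norm x"
        using GD(3)[OF x subspace_0[OF AD(7)]] GD(2) by simp
      ultimately show ?thesis
        using norm_triangle_ineq4[of "G (x + cscale z g) - G (cscale z g)" "G x"]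
        by (simp add: h_def Hline algebra_simps)
    qed
    then show ?thesis
      unfolding bounded_iff by blast
  qed
  ultimately have "h constant_on UNIV"
    by (rule Liouville_theorem)
  then have "h 1 = h 0"
    unfolding constant_on_def by auto
  moreover have "cscale 1 g = g" "cscale 0 g = 0"
    by (rule bcontfun_eqI; simp)+
  ultimately show ?thesis
    using GD(2) by (simp add: h_def Hline algebra_simps)
qed

section \<open>Isometries of uniform algebras\<close>

text \<open>Closed boundaries for \<open>B\<close>; a minimal one takes the role of the Shilov
  boundary.\<close>

definition norming :: "('k::topological_space \<Rightarrow>\<^sub>C complex) set \<Rightarrow> 'k set \<Rightarrow> bool"
  where "norming B E \<longleftrightarrow> closed E \<and> (\<forall>f\<in>B. \<exists>t\<in>E. cmod (apply_bcontfun f t) = norm f)"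

lemma bcontfun_attains_norm:
  fixes f :: "'k::topological_space \<Rightarrow>\<^sub>C complex"
  assumes "compact (UNIV :: 'k set)"
  obtains t where "cmod (apply_bcontfun f t) = norm f"
proof -
  obtain t where t: "\<And>s. cmod (apply_bcontfun f s) \<le> cmod (apply_bcontfun f t)"
    using continuous_attains_sup[OF assms UNIV_not_empty, of "\<lambda>s. cmod (apply_bcontfun f s)"]
      continuous_on_norm[OF continuous_on_apply_bcontfun] by blast
  have "norm f \<le> cmod (apply_bcontfun f t)"
    by (rule norm_bound) (rule t)
  with norm_bounded[of f t] that show ?thesis by simp
qed

text \<open>Zorn's lemma on the complements. For each \<open>f\<close> the norm-attaining points in
  the members of a chain form nested nonempty compact sets, so the intersection still norms
  \<open>f\<close>.\<close>

lemma minimal_norming_exists: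
  fixes B :: "('k::topological_space \<Rightarrow>\<^sub>C complex) set"
  assumes cpt: "compact (UNIV :: 'k set)"
  obtains E where "norming B E" "\<And>E'. norming B E' \<Longrightarrow> E' \<subseteq> E \<Longrightarrow> E' = E"
proof -
  have "\<exists>M\<in>{U. norming B (- U)}. \<forall>X\<in>{U. norming B (- U)}. M \<subseteq> X \<longrightarrow> X = M"
  proof (rule subset_Zorn_nonempty)
    have "norming B (- {})"
      unfolding norming_def using bcontfun_attains_norm[OF cpt] by auto
    then show "{U. norming B (- U)} \<noteq> {}" by blast
    fix C :: "'k set set" assume C: "C \<noteq> {}" "subset.chain {U. norming B (- U)} C"
    have nC: "norming B (- U)" if "U \<in> C" for U
      using C(2) that by (auto simp: subset_chain_def)
    have "\<exists>t\<in>- \<Union>C. cmod (apply_bcontfun f t) = norm f" if f: "f \<in> B" for f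
    proof -
      define K where "K = (\<lambda>U. - U \<inter> {t. cmod (apply_bcontfun f t) = norm f})"
      have "UNIV \<inter> (\<Inter>U\<in>C. K U) \<noteq> {}"
      proof (rule compact_imp_fip_image[OF cpt])
        show "closed (K U)" if "U \<in> C" for U
          using nC[OF that] unfolding K_def norming_def
          by (intro closed_Int closed_Collect_eq continuous_on_norm) auto
        fix I assume I: "finite I" "I \<subseteq> C"
        show "UNIV \<inter> (\<Inter>U\<in>I. K U) \<noteq> {}"
        proof (cases "I = {}")
          case False
          have "subset.chain {U. norming B (- U)} I"
            using C(2) I(2) unfolding subset_chain_def by (meson subsetD subset_trans)
          then have "\<Union>I \<in> I"
            using Union_in_chain I(1) False by blast
          then have "norming B (- \<Union>I)"
            using nC I(2) by (meson subsetD)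
          then have "\<exists>t\<in>- \<Union>I. cmod (apply_bcontfun f t) = norm f"
            using f by (simp add: norming_def)
          then show ?thesis by (auto simp: K_def)
        qed auto
      qed
      then obtain t where "\<And>U. U \<in> C \<Longrightarrow> t \<in> K U" by auto
      with C(1) show ?thesis by (fastforce simp: K_def)
    qed
    moreover have "closed (- \<Union>C)"
      using nC by (auto simp: norming_def closed_def intro!: open_Union)
    ultimately show "\<Union>C \<in> {U. norming B (- U)}"
      by (simp add: norming_def)
  qed
  then obtain M where "norming B (- M)" "\<And>X. norming B (- X) \<Longrightarrow> M \<subseteq> X \<Longrightarrow> X = M"
    by blast
  then show ?thesis
    using that[of "- M"] by (metis Compl_subset_Compl_iff double_complement)
qed

text \<open>By minimality \<open>E - U\<close> is not norming, so some \<open>h\<close> stays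
  strictly below its norm there. Compactness makes the gap uniform, and a high power of the
  normalised \<open>h\<close> is small on \<open>E - U\<close>.\<close>

lemma minimal_norming_peak:
  assumes B: "uniform_algebra B" and E: "norming B E"
    and min: "\<And>E'. norming B E' \<Longrightarrow> E' \<subseteq> E \<Longrightarrow> E' = E"
    and t: "t \<in> E" "t \<in> U" and U: "open U" and e: "e > 0"
  obtains h where "h \<in> B" "norm h = 1" "\<And>s. s \<in> E - U \<Longrightarrow> cmod (apply_bcontfun h s) < e"
proof -
  note BD = uniform_algebraD[OF B]
  have cl: "closed (E - U)"
    using E U by (auto simp: norming_def)
  have "\<not> norming B (E - U)"
    using min[of "E - U"] t by blast
  then obtain h where h: "h \<in> B" "\<And>s. s \<in> E - U \<Longrightarrow> cmod (apply_bcontfun h s) \<noteq> norm h"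
    using cl unfolding norming_def by blast
  then have lt: "cmod (apply_bcontfun h s) < norm h" if "s \<in> E - U" for s
    using that norm_bounded[of h s] by fastforce
  have ne: "E - U = {}" if "norm h = 0"
    using lt that by fastforce
  show ?thesis
  proof (cases "E - U = {}")
    case True
    then show ?thesis using that[of 1] BD(9) by auto
  next
    case False
    with ne have pos: "norm h > 0" by fastforce
    have cpt: "compact (E - U)"
      using compact_Int_closed[OF BD(1) cl] by simp
    obtain s0 where s0: "s0 \<in> E - U"
      "\<And>s. s \<in> E - U \<Longrightarrow> cmod (apply_bcontfun h s) \<le> cmod (apply_bcontfun h s0)"
      using continuous_attains_sup[OF cpt False, of "\<lambda>s. cmod (apply_bcontfun h s)"]
        continuous_on_norm[OF continuous_on_apply_bcontfun] by blast
    define q where "q = cmod (apply_bcontfun h s0) / norm h"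
    have q: "0 \<le> q" "q < 1"
      using lt[OF s0(1)] pos by (simp_all add: q_def)
    obtain n where n: "q ^ n < e"
      using real_arch_pow_inv[OF e q(2)] by blast
    define k where "k = cscale (of_real (1 / norm h)) h"
    have k: "k \<in> B" by (simp add: k_def BD h)
    have kval: "cmod (apply_bcontfun k s) = cmod (apply_bcontfun h s) / norm h" for s
      using pos by (simp add: k_def norm_mult norm_divide)
    obtain s1 where s1: "cmod (apply_bcontfun h s1) = norm h"
      using E h(1) unfolding norming_def by blast
    have "norm (k ^ n) = 1"
    proof (rule antisym)
      show "norm (k ^ n) \<le> 1"
        by (rule norm_bound)
          (use pos norm_bounded[of h] in \<open>simp add: norm_power kval power_le_one\<close>)
      have "cmod (apply_bcontfun (k ^ n) s1) = 1"
        using pos by (simp add: norm_power kval s1)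
      then show "1 \<le> norm (k ^ n)"
        using norm_bounded[of "k ^ n" s1] by simp
    qed
    moreover have "cmod (apply_bcontfun (k ^ n) s) < e" if "s \<in> E - U" for s
    proof -
      have "cmod (apply_bcontfun k s) \<le> q"
        using s0(2)[OF that] pos by (simp add: kval q_def divide_right_mono)
      then have "cmod (apply_bcontfun (k ^ n) s) \<le> q ^ n"
        by (simp add: norm_power power_mono)
      with n show ?thesis by simp
    qed
    ultimately show ?thesis
      using that[of "k ^ n"] BD(10)[OF k] by blast
  qed
qed

section \<open>Surjective isometries at points of a minimal norming set\<close>

lemma IsoD:
  assumes A: "uniform_algebra A" and T: "T \<in> Iso A B"
  shows "x \<in> A \<Longrightarrow> T x \<in> B" "x \<in> A \<Longrightarrow> y \<in> A \<Longrightarrow> T (x + y) = T x + T y"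
    "x \<in> A \<Longrightarrow> T (cscale c x) = cscale c (T x)" "x \<in> A \<Longrightarrow> y \<in> A \<Longrightarrow> T (x - y) = T x - T y"
    "T 0 = 0" "x \<in> A \<Longrightarrow> norm (T x) = norm x" "T ` A = B"
proof -
  note AD = uniform_algebraD[OF A]
  have lin: "linear_map A B T" and iso: "\<And>f g. f \<in> A \<Longrightarrow> g \<in> A \<Longrightarrow> dist (T f) (T g) = dist f g"
    using T by (auto simp: Iso_def)
  show "T ` A = B"
    using T by (auto simp: Iso_def)
  show add: "T (x + y) = T x + T y" if "x \<in> A" "y \<in> A" for x y
    using lin that by (auto simp: linear_map_def)
  show "x \<in> A \<Longrightarrow> T x \<in> B" "x \<in> A \<Longrightarrow> T (cscale c x) = cscale c (T x)"
    using lin by (auto simp: linear_map_def)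
  show "T (x - y) = T x - T y" if "x \<in> A" "y \<in> A"
    using add[of "x - y" y] that AD(8) by simp
  show T0: "T 0 = 0"
    using add[of 0 0] subspace_0[OF AD(7)] by simp
  show "norm (T x) = norm x" if "x \<in> A"
    using iso[OF that subspace_0[OF AD(7)]] T0 by simp
qed

text \<open>If \<open>T w\<close> were smaller than \<open>m\<close> near \<open>t\<close>, a function \<open>h\<close> peaking near \<open>t\<close> could be added to
  \<open>T w\<close> with an arbitrary phase while hardly increasing the norm.  The preimage \<open>g\<close> of \<open>h\<close> then has
  the same property with respect to \<open>w\<close>, so \<open>w\<close> is small wherever \<open>g\<close> attains its norm.\<close>

lemma Iso_lower_bound:
  assumes A: "uniform_algebra A" and B: "uniform_algebra B" and E: "norming B E"
    and min: "\<And>E'. norming B E' \<Longrightarrow> E' \<subseteq> E \<Longrightarrow> E' = E" and t: "t \<in> E"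
    and T: "T \<in> Iso A B" and w: "w \<in> A" and m: "\<And>s. m \<le> cmod (apply_bcontfun w s)"
  shows "m \<le> cmod (apply_bcontfun (T w) t)"
proof (rule ccontr)
  assume less: "\<not> ?thesis"
  note AD = uniform_algebraD[OF A] and BD = uniform_algebraD[OF B] and TD = IsoD[OF A T]
  \<comment> \<open>Here \<delta> lies halfway between the two values, \<mu> is what can be added
    where \<open>T w\<close> is below \<delta> without exceeding \<open>N\<close>, and
    \<open>e\<close> makes the surplus \<open>\<mu> * e\<close> elsewhere less than
    \<open>m - \<delta>\<close>.\<close>
  define \<delta> where "\<delta> = (cmod (apply_bcontfun (T w) t) + m) / 2"
  define N where "N = norm w"
  define \<mu> where "\<mu> = N - \<delta>"
  define e where "e = (m - \<delta>) / (2 * \<mu>)"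
  have \<delta>: "cmod (apply_bcontfun (T w) t) < \<delta>" "\<delta> < m"
    using less by (simp_all add: \<delta>_def)
  have "m \<le> N"
    unfolding N_def using m norm_bounded order_trans by blast
  with \<delta> have \<mu>: "\<mu> > 0" by (simp add: \<mu>_def)
  have e: "e > 0" "\<mu> * e < m - \<delta>"
    using \<mu> \<delta>(2) by (simp_all add: e_def field_simps)
  define U where "U = {s. cmod (apply_bcontfun (T w) s) < \<delta>}"
  have "open U"
    unfolding U_def by (intro open_Collect_less continuous_on_norm) auto
  moreover have "t \<in> U" using \<delta>(1) by (simp add: U_def)
  ultimately obtain h where h: "h \<in> B" "norm h = 1"
    "\<And>s. s \<in> E - U \<Longrightarrow> cmod (apply_bcontfun h s) < e"
    using minimal_norming_peak[OF B E min t] e(1) by metis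
  obtain g where g: "g \<in> A" "T g = h"
    using h(1) TD(7) by blast
  have "norm g = 1"
    using TD(6)[OF g(1)] g(2) h(2) by simp
  obtain s where s: "cmod (apply_bcontfun g s) = 1"
    using bcontfun_attains_norm[OF AD(1), of g] \<open>norm g = 1\<close> by metis
  \<comment> \<open>This phase makes the two summands at \<open>s\<close> point in the same
    direction; the direction 1 is chosen if \<open>w\<close> vanishes there.\<close>
  define c where "c = (if apply_bcontfun w s = 0 then 1 else sgn (apply_bcontfun w s)) / apply_bcontfun g s"
  have c: "cmod c = 1"
    by (simp add: c_def norm_divide norm_sgn s)
  have "apply_bcontfun w s + c * of_real \<mu> * apply_bcontfun g s =
      (if apply_bcontfun w s = 0 then 1 else sgn (apply_bcontfun w s)) *
      of_real (cmod (apply_bcontfun w s) + \<mu>)"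
    using s by (auto simp: c_def sgn_eq field_simps)
  then have "cmod (apply_bcontfun w s) + \<mu> =
      cmod (apply_bcontfun (w + cscale (c * of_real \<mu>) g) s)"
    using \<mu> by (simp add: norm_mult norm_sgn del: of_real_add)
  also have "\<dots> \<le> norm (w + cscale (c * of_real \<mu>) g)"
    by (rule norm_bounded)
  also have "\<dots> = norm (T w + cscale (c * of_real \<mu>) h)"
    using TD(6)[of "w + cscale (c * of_real \<mu>) g"] by (simp add: TD AD w g)
  also have "\<dots> \<le> N + \<mu> * e"
  proof -
    have "T w + cscale (c * of_real \<mu>) h \<in> B"
      by (simp add: BD TD w h)
    then obtain r where r: "r \<in> E"
      "cmod (apply_bcontfun (T w + cscale (c * of_real \<mu>) h) r) = norm (T w + cscale (c * of_real \<mu>) h)"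
      using E unfolding norming_def by blast
    have "cmod (apply_bcontfun (T w + cscale (c * of_real \<mu>) h) r) \<le>
        cmod (apply_bcontfun (T w) r) + \<mu> * cmod (apply_bcontfun h r)"
      using \<mu> c norm_triangle_ineq[of "apply_bcontfun (T w) r" "c * of_real \<mu> * apply_bcontfun h r"]
      by (simp add: norm_mult)
    also have "\<dots> \<le> N + \<mu> * e"
    proof (cases "r \<in> U")
      case True
      have "\<mu> * cmod (apply_bcontfun h r) \<le> \<mu>"
        using norm_bounded[of h r] h(2) \<mu> by (simp add: mult_left_le)
      moreover have "0 \<le> \<mu> * e" using \<mu> e(1) by simp
      ultimately show ?thesis
        using True by (simp add: U_def \<mu>_def)
    next
      case False
      then have "cmod (apply_bcontfun h r) < e" using h(3) r(1) by blast
      then have "\<mu> * cmod (apply_bcontfun h r) \<le> \<mu> * e"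
        using \<mu> by simp
      then show ?thesis
        using norm_bounded[of "T w" r] TD(6)[OF w] by (simp add: N_def)
    qed
    finally show ?thesis using r(2) by simp
  qed
  finally have "cmod (apply_bcontfun w s) \<le> N + \<mu> * e - \<mu>" by simp
  then show False
    using m[of s] e(2) by (simp add: \<mu>_def)
qed

section \<open>Algebra isomorphisms are isometric\<close>

lemma alg_isosD:
  assumes A: "uniform_algebra A" and B: "uniform_algebra B" and T: "T \<in> alg_isos A B"
  shows "x \<in> A \<Longrightarrow> y \<in> A \<Longrightarrow> T (x - y) = T x - T y" "T 1 = 1" "inv_into A T \<in> alg_isos B A"
proof -
  note AD = uniform_algebraD[OF A] and BD = uniform_algebraD[OF B]
  have lin: "linear_map A B T" and mult: "\<And>f g. f \<in> A \<Longrightarrow> g \<in> A \<Longrightarrow> T (f * g) = T f * T g"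
    and bij: "bij_betw T A B"
    using T by (auto simp: alg_isos_def)
  have add: "T (x + y) = T x + T y" if "x \<in> A" "y \<in> A" for x y
    using lin that by (auto simp: linear_map_def)
  show "T (x - y) = T x - T y" if "x \<in> A" "y \<in> A"
    using add[of "x - y" y] that AD(8) by simp
  obtain u where u: "u \<in> A" "T u = 1"
    using bij BD(9) by (metis bij_betw_iff_bijections)
  show "T 1 = 1"
    using mult[OF AD(9) u(1)] u(2) by simp
  let ?S = "inv_into A T"
  have S: "?S y \<in> A" "T (?S y) = y" if "y \<in> B" for y
    using that bij by (auto simp: bij_betw_def inv_into_into f_inv_into_f)
  have ST: "?S (T x) = x" if "x \<in> A" for x
    using that bij by (simp add: bij_betw_inv_into_left)
  have "linear_map B A ?S"
    unfolding linear_map_def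
  proof (intro conjI ballI allI)
    show "?S \<in> B \<rightarrow> A" using S by auto
    show "?S (f + g) = ?S f + ?S g" if "f \<in> B" "g \<in> B" for f g
      using ST[of "?S f + ?S g"] that by (simp add: S AD add)
    show "?S (cscale c f) = cscale c (?S f)" if "f \<in> B" for c f
      using ST[of "cscale c (?S f)"] that lin by (simp add: S AD linear_map_def)
  qed
  moreover have "?S (f * g) = ?S f * ?S g" if "f \<in> B" "g \<in> B" for f g
    using ST[of "?S f * ?S g"] that by (simp add: S AD mult)
  ultimately show "inv_into A T \<in> alg_isos B A"
    using bij bij_betw_inv_into by (auto simp: alg_isos_def)
qed

lemma uniform_algebra_inverse:
  assumes A: "uniform_algebra A" and f: "f \<in> A" "norm f < 1"
  obtains y where "y \<in> A" "(1 - f) * y = 1"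
proof -
  have "summable (\<lambda>n. cmod 1 * norm f ^ n)"
    using f(2) by (simp add: summable_geometric)
  then obtain y where y: "y \<in> A" "\<And>s. (\<lambda>n. 1 * apply_bcontfun f s ^ n) sums apply_bcontfun y s"
    by (rule uniform_algebra_power_series[OF A f(1)]) (rule that)
  have "(1 - f) * y = 1"
  proof (rule bcontfun_eqI)
    fix s
    have lt: "cmod (apply_bcontfun f s) < 1"
      using norm_bounded[of f s] f(2) by simp
    then have "apply_bcontfun f s \<noteq> 1" by auto
    moreover have "apply_bcontfun y s = 1 / (1 - apply_bcontfun f s)"
      using sums_unique2[OF y(2)[of s]] geometric_sums[OF lt] by simp
    ultimately show "apply_bcontfun ((1 - f) * y) s = apply_bcontfun 1 s"
      by simp
  qed
  with y(1) that show ?thesis by blast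
qed

text \<open>If the value \<open>l\<close> of \<open>T f\<close> at some \<open>t\<close> exceeded
  \<open>norm f\<close> in modulus, \<open>1 - f / l\<close> would be invertible in \<open>A\<close>
  by the Neumann series, while its image under \<open>T\<close> vanishes at
  \<open>t\<close>.\<close>

lemma alg_isos_norm_le:
  assumes A: "uniform_algebra A" and B: "uniform_algebra B" and T: "T \<in> alg_isos A B" and f: "f \<in> A"
  shows "norm (T f) \<le> norm f"
proof (rule norm_bound, rule ccontr)
  fix t
  note AD = uniform_algebraD[OF A]
  let ?l = "apply_bcontfun (T f) t"
  assume "\<not> cmod ?l \<le> norm f"
  then have lt: "norm f < cmod ?l" by simp
  then have l: "?l \<noteq> 0" by auto
  define g where "g = cscale (1 / ?l) f"
  have g: "g \<in> A" by (simp add: g_def AD f)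
  have "norm g \<le> cmod (1 / ?l) * norm f"
    unfolding g_def by (rule norm_cscale)
  also have "\<dots> < 1"
    using lt l by (simp add: norm_divide)
  finally obtain y where y: "y \<in> A" "(1 - g) * y = 1"
    using uniform_algebra_inverse[OF A g] by blast
  have "T (1 - g) * T y = T ((1 - g) * y)"
    using T AD(8)[OF AD(9) g] y(1) by (simp add: alg_isos_def)
  also have "\<dots> = 1"
    using y(2) alg_isosD(2)[OF A B T] by simp
  finally have "apply_bcontfun (T (1 - g)) t * apply_bcontfun (T y) t = 1"
    by (metis apply_bcontfun_one times_bcontfun.rep_eq)
  moreover have "T g = cscale (1 / ?l) (T f)"
    using T f by (simp add: g_def alg_isos_def linear_map_def)
  then have "apply_bcontfun (T (1 - g)) t = 0"
    using l by (simp add: alg_isosD[OF A B T] AD g)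
  ultimately show False by simp
qed

text \<open>Both \<open>T\<close> and its inverse are contractive.\<close>

lemma alg_isos_subset_Iso:
  assumes A: "uniform_algebra A" and B: "uniform_algebra B"
  shows "alg_isos A B \<subseteq> Iso A B"
proof
  fix T assume T: "T \<in> alg_isos A B"
  note AD = uniform_algebraD[OF A]
  have bij: "bij_betw T A B" and lin: "linear_map A B T"
    using T by (auto simp: alg_isos_def)
  have norm: "norm (T f) = norm f" if f: "f \<in> A" for f
  proof (rule antisym)
    show "norm (T f) \<le> norm f"
      by (rule alg_isos_norm_le[OF A B T f])
    have "T f \<in> B" using bij f by (auto simp: bij_betw_def)
    from alg_isos_norm_le[OF B A alg_isosD(3)[OF A B T] this]
    show "norm f \<le> norm (T f)"
      using bij f by (simp add: bij_betw_inv_into_left)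
  qed
  have "dist (T f) (T g) = dist f g" if "f \<in> A" "g \<in> A" for f g
    using norm[OF AD(8)[OF that]] that by (simp add: dist_norm alg_isosD(1)[OF A B T])
  then show "T \<in> Iso A B"
    using lin bij by (auto simp: Iso_def bij_betw_def)
qed

section \<open>Two-local isometries are linear\<close>

text \<open>Equality in the triangle inequality puts the value at \<open>(n + 1) * c\<close> on the
  ray through \<open>h c\<close>, so \<open>h\<close> respects these multiples. A nonzero deviation
  from \<open>\<alpha> * c\<close> would then grow beyond \<open>K\<close>.\<close>

lemma complex_isometry_near_linear:
  fixes h :: "complex \<Rightarrow> complex"
  assumes iso: "\<And>c d. cmod (h c - h d) = cmod (c - d)" and h0: "h 0 = 0"
    and near: "\<And>c. cmod (h c - \<alpha> * c) \<le> K"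
  shows "h c = \<alpha> * c"
proof (rule ccontr)
  assume ne: "h c \<noteq> \<alpha> * c"
  have norm: "cmod (h d) = cmod d" for d
    using iso[of d 0] h0 by simp
  have mult: "h (of_nat (Suc n) * c) = of_nat (Suc n) * h c" for n
  proof (cases "c = 0")
    case False
    have nc: "cmod (h (of_nat (Suc n) * c) - h c) = real n * cmod c"
      unfolding iso by (simp add: algebra_simps norm_mult)
    have tri: "cmod ((h (of_nat (Suc n) * c) - h c) + h c) = cmod (h (of_nat (Suc n) * c) - h c) + cmod (h c)"
      unfolding nc by (simp add: norm norm_mult algebra_simps del: of_nat_Suc) (simp add: algebra_simps)
    have "(real n * cmod c) *\<^sub>R h c = cmod c *\<^sub>R (h (of_nat (Suc n) * c) - h c)"
      using norm_triangle_eq[THEN iffD1, OF tri] unfolding nc norm .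
    then have "of_real (cmod c) * (of_nat n * h c) = of_real (cmod c) * (h (of_nat (Suc n) * c) - h c)"
      by (simp add: scaleR_conv_of_real mult_ac del: of_nat_Suc)
    then have "of_nat n * h c = h (of_nat (Suc n) * c) - h c"
      using False by simp
    then show ?thesis
      by (simp add: algebra_simps)
  qed (simp add: h0)
  obtain n :: nat where "K < real n * cmod (h c - \<alpha> * c)"
    using reals_Archimedean3[of "cmod (h c - \<alpha> * c)"] ne by auto
  also have "\<dots> \<le> real (Suc n) * cmod (h c - \<alpha> * c)"
    by (intro mult_right_mono) auto
  also have "\<dots> = cmod (h (of_nat (Suc n) * c) - \<alpha> * (of_nat (Suc n) * c))"
  proof -
    have "h (of_nat (Suc n) * c) - \<alpha> * (of_nat (Suc n) * c) = of_nat (Suc n) * (h c - \<alpha> * c)"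
      unfolding mult by (simp only: right_diff_distrib mult.left_commute)
    then show ?thesis
      by (simp only: norm_mult norm_of_nat)
  qed
  also have "\<dots> \<le> K" by (rule near)
  finally show False by simp
qed

text \<open>A single \<open>T\<close> represents \<Delta> at both \<open>x\<close> and
  \<open>y\<close>, so \<open>F x - F y\<close> is the value of \<open>T (x - y)\<close> at
  \<open>t\<close>: isometry gives the upper bound, and \<open>Iso_lower_bound\<close> the lower
  one.\<close>

lemma two_local_isometry_pinched:
  assumes A: "uniform_algebra A" and B: "uniform_algebra B" and E: "norming B E"
    and min: "\<And>E'. norming B E' \<Longrightarrow> E' \<subseteq> E \<Longrightarrow> E' = E" and t: "t \<in> E"
    and \<Delta>: "two_local_isometry A B \<Delta>"
  defines "\<alpha> \<equiv> apply_bcontfun (\<Delta> 1) t"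
  shows "\<alpha> \<noteq> 0" "(\<lambda>x. if x \<in> A then apply_bcontfun (\<Delta> x) t else 0) \<in> pinched A \<alpha>"
proof -
  note AD = uniform_algebraD[OF A]
  define F where "F = (\<lambda>x. if x \<in> A then apply_bcontfun (\<Delta> x) t else 0)"
  have two: "\<exists>T\<in>Iso A B. F x = apply_bcontfun (T x) t \<and> F y = apply_bcontfun (T y) t"
    if "x \<in> A" "y \<in> A" for x y
    using \<Delta> that unfolding two_local_isometry_def F_def by metis
  have diff: "\<exists>T\<in>Iso A B. F x - F y = apply_bcontfun (T (x - y)) t" if xy: "x \<in> A" "y \<in> A" for x y
    using two[OF xy] IsoD(4)[OF A _ xy] by (metis minus_bcontfun.rep_eq)
  have upper: "cmod (F x - F y) \<le> norm (x - y)" if xy: "x \<in> A" "y \<in> A" for x y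
    using diff[OF xy] IsoD(6)[OF A _ AD(8)[OF xy]] norm_bounded by metis
  have lower: "m \<le> cmod (F x - F y)"
    if xy: "x \<in> A" "y \<in> A" and m: "\<And>s. m \<le> cmod (apply_bcontfun (x - y) s)" for x y m
    using diff[OF xy] Iso_lower_bound[OF A B E min t _ AD(8)[OF xy] m] by auto
  have F0: "F 0 = 0"
    using two[OF subspace_0[OF AD(7)] subspace_0[OF AD(7)]] IsoD(5)[OF A] by (metis zero_bcontfun.rep_eq)
  have F1: "F 1 = \<alpha>"
    by (simp add: F_def AD \<alpha>_def)
  have scale: "F (cscale c x) = c * F x" if x: "x \<in> A" for c x
    using two[OF x AD(4)[OF x, of c]] IsoD(3)[OF A _ x, of _ B c] by (metis apply_cscale)
  have Fc: "F (const_bcontfun c) = c * \<alpha>" for c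
  proof -
    have "F (const_bcontfun c) = F (cscale c 1)"
      by (intro arg_cong[where f = F] bcontfun_eqI) simp
    then show ?thesis
      using scale[OF AD(9)] F1 by simp
  qed
  have "1 \<le> cmod (F 1 - F 0)"
    by (rule lower) (simp_all add: AD subspace_0)
  then show "\<alpha> \<noteq> 0"
    using F0 F1 by auto
  \<comment> \<open>For shifts by constants the two bounds coincide, so the increment is an isometry
    in \<open>c\<close>. It stays within \<open>2 * norm x\<close> of \<open>\<alpha> * c\<close>,
    since replacing \<open>x\<close> by 0 in each of its two terms costs at most
    \<open>norm x\<close>.\<close>
  have const: "F (x + const_bcontfun c) = F x + \<alpha> * c" if x: "x \<in> A" for x c
  proof -
    have mem: "x + const_bcontfun c \<in> A" for c
      by (simp add: AD x)
    have "F (x + const_bcontfun c) - F x = \<alpha> * c"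
    proof (rule complex_isometry_near_linear)
      fix c d
      have val: "cmod (apply_bcontfun ((x + const_bcontfun c) - (x + const_bcontfun d)) s) = cmod (c - d)" for s
        by simp
      show "cmod ((F (x + const_bcontfun c) - F x) - (F (x + const_bcontfun d) - F x)) = cmod (c - d)"
      proof (rule antisym)
        have "norm ((x + const_bcontfun c) - (x + const_bcontfun d)) \<le> cmod (c - d)"
          by (rule norm_bound) (simp add: val)
        then show "cmod ((F (x + const_bcontfun c) - F x) - (F (x + const_bcontfun d) - F x)) \<le> cmod (c - d)"
          using upper[OF mem mem, of c d] by simp
        show "cmod (c - d) \<le> cmod ((F (x + const_bcontfun c) - F x) - (F (x + const_bcontfun d) - F x))"
          using lower[OF mem mem, of "cmod (c - d)" c d] val by simp
      qed
    next
      fix c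
      have "cmod (F (x + const_bcontfun c) - F (const_bcontfun c)) \<le> norm x"
        using upper[OF mem AD(6), of c c] by simp
      moreover have "cmod (F x) \<le> norm x"
        using upper[OF x subspace_0[OF AD(7)]] F0 by simp
      ultimately show "cmod (F (x + const_bcontfun c) - F x - \<alpha> * c) \<le> 2 * norm x"
        using norm_triangle_ineq4[of "F (x + const_bcontfun c) - F (const_bcontfun c)" "F x"]
        by (simp add: Fc algebra_simps)
    qed simp
    then show ?thesis by (simp add: algebra_simps)
  qed
  have "F x = 0" if "x \<notin> A" for x
    using that by (simp add: F_def)
  then have "F \<in> pinched A \<alpha>"
    using F0 upper lower const by (simp add: pinched_def)
  then show "(\<lambda>x. if x \<in> A then apply_bcontfun (\<Delta> x) t else 0) \<in> pinched A \<alpha>"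
    by (simp add: F_def)
qed

text \<open>Additivity holds at each point of \<open>E\<close>, and the defect, being in
  \<open>B\<close>, attains its norm on \<open>E\<close>. Homogeneity comes from the
  \<open>T\<close> for the pair \<open>f\<close>, \<open>cscale c f\<close>.\<close>

lemma two_local_isometry_linear:
  assumes A: "uniform_algebra A" and B: "uniform_algebra B" and \<Delta>: "two_local_isometry A B \<Delta>"
  shows "linear_map A B \<Delta>"
proof -
  note AD = uniform_algebraD[OF A] and BD = uniform_algebraD[OF B]
  obtain E where E: "norming B E" "\<And>E'. norming B E' \<Longrightarrow> E' \<subseteq> E \<Longrightarrow> E' = E"
    by (rule minimal_norming_exists[OF BD(1)]) blast
  have maps: "\<Delta> \<in> A \<rightarrow> B"
    using \<Delta> by (simp add: two_local_isometry_def)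
  have "\<Delta> (f + g) = \<Delta> f + \<Delta> g" if fg: "f \<in> A" "g \<in> A" for f g
  proof -
    have zero: "apply_bcontfun (\<Delta> (f + g) - \<Delta> f - \<Delta> g) t = 0" if t: "t \<in> E" for t
      using pinched_additive[OF A two_local_isometry_pinched[OF A B E t \<Delta>] fg] fg AD(3)[OF fg]
      by simp
    have "\<Delta> (f + g) - \<Delta> f - \<Delta> g \<in> B"
      using maps fg AD(3)[OF fg] by (auto intro!: BD(8))
    then obtain t where "t \<in> E"
      "cmod (apply_bcontfun (\<Delta> (f + g) - \<Delta> f - \<Delta> g) t) = norm (\<Delta> (f + g) - \<Delta> f - \<Delta> g)"
      using E(1) unfolding norming_def by blast
    then have "norm (\<Delta> (f + g) - \<Delta> f - \<Delta> g) = 0"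
      using zero by (metis norm_zero)
    then show ?thesis by (simp add: algebra_simps)
  qed
  moreover have "\<Delta> (cscale c f) = cscale c (\<Delta> f)" if f: "f \<in> A" for c f
  proof -
    obtain T where "T \<in> Iso A B" "\<Delta> f = T f" "\<Delta> (cscale c f) = T (cscale c f)"
      using \<Delta> f AD(4)[OF f, of c] unfolding two_local_isometry_def by blast
    then show ?thesis
      using IsoD(3)[OF A _ f] by metis
  qed
  ultimately show ?thesis
    using maps by (simp add: linear_map_def)
qed

theorem corollary3p10:
  fixes A :: "('k::t2_space \<Rightarrow>\<^sub>C complex) set"
    and B :: "('l::t2_space \<Rightarrow>\<^sub>C complex) set"
  assumes "uniform_algebra A" and "uniform_algebra B"
  shows "(\<forall>\<Delta>. two_local_isometry A B \<Delta> \<longrightarrow> linear_map A B \<Delta>) \<and>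
    (\<forall>\<Delta>. two_local_isomorphism A B \<Delta> \<longrightarrow> linear_map A B \<Delta>) \<and>
    ((\<forall>T. local_isometry A B T \<longrightarrow> T \<in> Iso A B) \<longrightarrow>
      (\<forall>\<Delta>. two_local_isometry A B \<Delta> \<longrightarrow> \<Delta> \<in> Iso A B)) \<and>
    ((\<forall>T. local_isomorphism A B T \<longrightarrow> T \<in> alg_isos A B) \<longrightarrow>
      (\<forall>\<Delta>. two_local_isomorphism A B \<Delta> \<longrightarrow> \<Delta> \<in> alg_isos A B))"
proof -
  have isometry: "linear_map A B \<Delta>" if "two_local_isometry A B \<Delta>" for \<Delta>
    by (rule two_local_isometry_linear[OF assms that])
  have isomorphism: "linear_map A B \<Delta>" if "two_local_isomorphism A B \<Delta>" for \<Delta>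
  proof (rule isometry)
    show "two_local_isometry A B \<Delta>"
      using that alg_isos_subset_Iso[OF assms]
      unfolding two_local_isomorphism_def two_local_isometry_def by (meson subsetD)
  qed
  \<comment> \<open>With linearity known, taking the pair \<open>x\<close>, \<open>x\<close> gives
    the local property, to which the hypothesis on local maps applies.\<close>
  have "local_isometry A B \<Delta>" if "two_local_isometry A B \<Delta>" for \<Delta>
    using isometry[OF that] that unfolding two_local_isometry_def local_isometry_def by blast
  moreover have "local_isomorphism A B \<Delta>" if "two_local_isomorphism A B \<Delta>" for \<Delta>
    using isomorphism[OF that] that unfolding two_local_isomorphism_def local_isomorphism_def by blast
  ultimately show ?thesis
    using isometry isomorphism by blast
qed

end
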